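(* Suppose $\rho\in(0,(1+\sqrt5)/2)$ and $\mu_1,\mu_2>0$. Let $\{(\mathcal L^t,\Delta\tau^t,(\mathbf A^t,\mathcal B^t),\mathcal O_1^t,\mathcal O_2^t)\}_{t\in\mathbb N}$ be the sequence generated by the symmetric Gauss--Seidel ADMM (sGS-ADMM) algorithm described in the context, applied to the convex problem $$\min_{\mathcal L,\Delta\tau,\mathbf A,\mathcal B}\|\mathcal L\|_{\mathrm{TNN}}\quad\text{s.t.}\quad \mathcal H_{spa}(\mathcal L\times_3\mathbf D)=\mathcal Y\circ\tau^k+\mathcal J(\Delta\tau),\qquad \mathcal H_{spec}(\mathcal L\times_3\mathbf D)=\mathcal Z\times_3\mathbf A+\mathcal B .\qquad (P)$$ Then the sequence $\{(\mathcal L^t,\Delta\tau^t,(\mathbf A^t,\mathcal B^t))\}_{t\in\mathbb N}$ converges to an optimal solution of (P), and the sequence $\{(\mathcal O_1^t,\mathcal O_2^t)\}_{t\in\mathbb N}$ converges to an optimal solution of the dual of (P).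
   Context: Notation. $m<M$, $n<N$, $h<H$ are positive integers. $\mathcal X_{(3)}$ is the mode-3 unfolding of a third-order tensor (for $\mathcal X\in\mathbb R^{M\times N\times H}$ a matrix in $\mathbb R^{H\times MN}$), $\mathrm{fold}_3$ is the inverse operation, and $\mathcal L\times_3\mathbf D$ is the mode-3 product, $(\mathcal L\times_3\mathbf D)_{(3)}=\mathbf D\mathcal L_{(3)}$. $\mathcal Z\in\mathbb R^{M\times N\times h}$ and the tensor $\mathcal Y\circ\tau^k\in\mathbb R^{m\times n\times H}$ (a fixed warped image at the current transformation parameters $\tau^k$) are given data. Unknowns: $\mathcal L\in\mathbb R^{M\times N\times L}$, $\Delta\tau\in\mathbb R^{p\times H}$, $\mathbf A\in\mathbb R^{h\times h}$, $\mathcal B\in\mathbb R^{M\times N\times h}$. $\mathcal H_{spa}(\mathcal X)=\mathrm{fold}_3(\mathcal X_{(3)}\mathbf B\mathbf S)$ with $\mathbf B\in\mathbb R^{MN\times MN}$ a blurring matrix (a convolution with circular boundary conditions) and $\mathbf S\in\mathbb R^{MN\times mn}$ a downsampling matrix whose columns are a subset of the columns of the identity; $\mathcal H_{spec}(\mathcal X)=\mathrm{fold}_3(\mathbf R\mathcal X_{(3)})$ with $\mathbf R\in\mathbb R^{h\times H}$; $\mathbf D\in\mathbb R^{H\times L}$ satisfies $\mathbf D^\top\mathbf D=\mathbf I$. $\mathcal J(\Delta\tau)=\mathrm{fold}_3\big((\sum_{i=1}^H\mathbf J_i\Delta\tau\,\epsilon_i\epsilon_i^\top)^\top\big)$, where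 $\mathbf J_i\in\mathbb R^{mn\times p}$ are given (Jacobian) matrices and $\{\epsilon_i\}$ is the standard basis of $\mathbb R^H$. Tensor nuclear norm: with $\hat{\mathcal X}$ the discrete Fourier transform of $\mathcal X\in\mathbb R^{n_1\times n_2\times n_3}$ along the third mode and $\hat{\mathbf X}^{(i)}$ its frontal slices, $\|\mathcal X\|_{\mathrm{TNN}}=\frac1{n_3}\sum_i\|\hat{\mathbf X}^{(i)}\|_*$. Augmented Lagrangian. With multipliers $\mathcal O_1\in\mathbb R^{m\times n\times H}$, $\mathcal O_2\in\mathbb R^{M\times N\times h}$, $$\Theta(\mathcal L,\Delta\tau,\mathbf A,\mathcal B,\mathcal O_1,\mathcal O_2)=\|\mathcal L\|_{\mathrm{TNN}}+\tfrac{\mu_1}{2}\big\|\mathcal H_{spa}(\mathcal L\times_3\mathbf D)-(\mathcal Y\circ\tau^k+\mathcal J(\Delta\tau))+\tfrac{\mathcal O_1}{\mu_1}\big\|_F^2+\tfrac{\mu_2}{2}\big\|\mathcal H_{spec}(\mathcal L\times_3\mathbf D)-(\mathcal Z\times_3\mathbf A+\mathcal B)+\tfrac{\mathcal O_2}{\mu_2}\big\|_F^2 .$$ sGS-ADMM iteration, from an arbitrary initial point: $\Delta\tau^{t+1/2}\in\arg\min_{\Delta\tau}\Theta(\mathcal L^t,\Delta\tau,\mathbf A^t,\mathcal B^t,\mathcal O_1^t,\mathcal O_2^t)$; $\mathcal L^{t+1}\in\arg\min_{\mathcal L}\Theta(\mathcal L,\Delta\tau^{t+1/2},\mathbf A^t,\mathcal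 B^t,\mathcal O_1^t,\mathcal O_2^t)$; $\Delta\tau^{t+1}\in\arg\min_{\Delta\tau}\Theta(\mathcal L^{t+1},\Delta\tau,\mathbf A^t,\mathcal B^t,\mathcal O_1^t,\mathcal O_2^t)$; $(\mathbf A^{t+1},\mathcal B^{t+1})\in\arg\min_{\mathbf A,\mathcal B}\Theta(\mathcal L^{t+1},\Delta\tau^{t+1},\mathbf A,\mathcal B,\mathcal O_1^t,\mathcal O_2^t)$; $\mathcal O_1^{t+1}=\mathcal O_1^t+\rho\mu_1\big(\mathcal H_{spa}(\mathcal L^{t+1}\times_3\mathbf D)-(\mathcal Y\circ\tau^k+\mathcal J(\Delta\tau^{t+1}))\big)$; $\mathcal O_2^{t+1}=\mathcal O_2^t+\rho\mu_2\big(\mathcal H_{spec}(\mathcal L^{t+1}\times_3\mathbf D)-(\mathcal Z\times_3\mathbf A^{t+1}+\mathcal B^{t+1})\big)$. The minimizers in $\Delta\tau$ and $(\mathbf A,\mathcal B)$ are least-squares solutions selected by the Moore--Penrose pseudoinverse $\dagger$: $\Delta\tau=\sum_{i=1}^H\mathbf J_i^\dagger\mathbf M\epsilon_i\epsilon_i^\top$ with $\mathbf M=(\mathcal H_{spa}(\mathcal L\times_3\mathbf D)+\mathcal O_1/\mu_1-\mathcal Y\circ\tau^k)_{(3)}^\top$, and $(\mathbf A,\mathcal B_{(3)})=\big(\mathbf R\mathbf D\mathcal L_{(3)}+(\mathcal O_2)_{(3)}/\mu_2\big)\begin{pmatrix}\mathcal Z_{(3)}\\ \mathbf I\end{pmatrix}^{\dagger}$.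 Each $\mathcal L$-subproblem is solved exactly. Dual of (P): the Lagrangian dual, i.e. maximize over $(\mathcal O_1,\mathcal O_2)$ the function $\inf_{\mathcal L,\Delta\tau,\mathbf A,\mathcal B}\big\{\|\mathcal L\|_{\mathrm{TNN}}+\langle\mathcal O_1,\mathcal H_{spa}(\mathcal L\times_3\mathbf D)-\mathcal Y\circ\tau^k-\mathcal J(\Delta\tau)\rangle+\langle\mathcal O_2,\mathcal H_{spec}(\mathcal L\times_3\mathbf D)-\mathcal Z\times_3\mathbf A-\mathcal B\rangle\big\}$.
   Formalization: Adds two assumptions, for both the primal and the dual conclusion: (P) has a feasible point, and no two optimal solutions of (P) differ only in their L-component; without them (P) may have no optimal solution, or L^t may diverge since the L-subproblem's minimizer need not be unique. *)

theory Defs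
  imports "HOL-Analysis.Analysis" "HOL-Library.Extended_Real"
begin

section \<open>Tensors and matrices\<close>

text \<open>
  An \<open>n1 \<times> n2 \<times> n3\<close> tensor is indexed by three finite types.
  The library norm and inner product of this type are the Frobenius norm and inner product.
\<close>

type_synonym ('n1, 'n2, 'n3) tensor = "(((real, 'n3) vec, 'n2) vec, 'n1) vec"

text \<open>
  The columns of the mode-3 unfolding are indexed by pairs, so that no linear ordering of
  the \<open>n1 * n2\<close> columns has to be chosen.
\<close>

definition unfold3 :: "('n1::finite, 'n2::finite, 'n3::finite) tensor \<Rightarrow> real^('n1 \<times> 'n2)^'n3" where
  "unfold3 X = (\<chi> k. \<chi> q. X $ fst q $ snd q $ k)"

definition fold3 :: "real^('n1 \<times> 'n2)^'n3 \<Rightarrow> ('n1::finite, 'n2::finite, 'n3::finite) tensor" where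
  "fold3 A = (\<chi> i. \<chi> j. \<chi> k. A $ k $ (i, j))"

lemma fold3_unfold3 [simp]: "fold3 (unfold3 X) = X"
  by (simp add: fold3_def unfold3_def vec_eq_iff)

lemma unfold3_fold3 [simp]: "unfold3 (fold3 A) = A"
  by (simp add: fold3_def unfold3_def vec_eq_iff)

definition mode3 :: "('n1::finite, 'n2::finite, 'k::finite) tensor \<Rightarrow> real^'k^'l \<Rightarrow> ('n1, 'n2, 'l::finite) tensor"
    (infixl "\<times>\<^sub>3" 75) where
  "X \<times>\<^sub>3 D = fold3 (D ** unfold3 X)"

definition hcat :: "real^'a^'r \<Rightarrow> real^'b^'r \<Rightarrow> real^('a + 'b)^'r" where
  "hcat A B = (\<chi> i. \<chi> j. case j of Inl a \<Rightarrow> A $ i $ a | Inr b \<Rightarrow> B $ i $ b)"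

definition vcat :: "real^'c^'a \<Rightarrow> real^'c^'b \<Rightarrow> real^'c^('a + 'b)" where
  "vcat A B = (\<chi> i. case i of Inl a \<Rightarrow> A $ a | Inr b \<Rightarrow> B $ b)"

text \<open>The Moore--Penrose pseudoinverse, characterized by the four Penrose equations.\<close>

definition pinv :: "real^'n^'m \<Rightarrow> real^'m^'n" where
  "pinv A = (THE X. A ** X ** A = A \<and> X ** A ** X = X \<and>
                    transpose (A ** X) = A ** X \<and> transpose (X ** A) = X ** A)"


section \<open>Tensor nuclear norm\<close>

text \<open>
  Zero-based position of an index in its (linearly ordered, finite) index type. An order is
  only needed on those index types on which the index arithmetic modulo the dimension matters,
  namely for the discrete Fourier transform and for circular convolutions.
\<close>

definition pos :: "'a::{finite, linorder} \<Rightarrow> nat" where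
  "pos i = card {j. j < i}"

definition ctranspose :: "complex^'n^'m \<Rightarrow> complex^'m^'n" where
  "ctranspose A = (\<chi> i. \<chi> j. cnj (A $ j $ i))"

definition sv_space :: "complex^'n^'m \<Rightarrow> real \<Rightarrow> (complex^'n) set" where
  "sv_space A \<sigma> = {v. (ctranspose A ** A) *v v = complex_of_real (\<sigma>\<^sup>2) *s v}"

definition singular_values :: "complex^'n^'m \<Rightarrow> real set" where
  "singular_values A = {\<sigma>. \<sigma> > 0 \<and> (\<exists>v \<in> sv_space A \<sigma>. v \<noteq> 0)}"

text \<open>
  Sum of the singular values with multiplicity; the multiplicity of \<open>\<sigma>\<close> is the
  complex dimension of the eigenspace of \<open>A\<^sup>H A\<close> for \<open>\<sigma>\<^sup>2\<close>.
\<close>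

definition nuclear_norm :: "complex^'n^'m \<Rightarrow> real" where
  "nuclear_norm A = (\<Sum>\<sigma> \<in> singular_values A. real (vec.dim (sv_space A \<sigma>)) * \<sigma>)"

definition dft_slice ::
    "('n1::finite, 'n2::finite, 'n3::{finite, linorder}) tensor \<Rightarrow> 'n3 \<Rightarrow> complex^'n2^'n1" where
  "dft_slice X k = (\<chi> i. \<chi> j. \<Sum>l\<in>UNIV.
     complex_of_real (X $ i $ j $ l) * cis (- 2 * pi * real (pos k) * real (pos l) / real CARD('n3)))"

definition tnn :: "('n1::finite, 'n2::finite, 'n3::{finite, linorder}) tensor \<Rightarrow> real" where
  "tnn X = (1 / real CARD('n3)) * (\<Sum>k\<in>UNIV. nuclear_norm (dft_slice X k))"


section \<open>Problem data\<close>

text \<open>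
  \<open>Ywarp\<close> is the warped image at the current transformation parameters, and \<open>Jac i\<close> is the
  Jacobian matrix belonging to the \<open>i\<close>-th band.
\<close>

record ('M, 'N, 'H, 'm, 'n, 'h, 'l, 'p) data =
  Blur :: "((real, 'M \<times> 'N) vec, 'M \<times> 'N) vec"
  Down :: "((real, 'm \<times> 'n) vec, 'M \<times> 'N) vec"
  Spec :: "((real, 'H) vec, 'h) vec"
  Dict :: "((real, 'l) vec, 'H) vec"
  Jac :: "'H \<Rightarrow> ((real, 'p) vec, 'm \<times> 'n) vec"
  Ywarp :: "('m, 'n, 'H) tensor"
  Zdata :: "('M, 'N, 'h) tensor"

text \<open>
  Right multiplication by such a matrix convolves every row of an unfolded tensor, read as an
  \<open>M \<times> N\<close> image, with the kernel \<open>\<kappa>\<close> under circular boundary conditions.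
\<close>

definition circular_convolution ::
    "real^('M::{finite, linorder} \<times> 'N::{finite, linorder})^('M \<times> 'N) \<Rightarrow> bool" where
  "circular_convolution B \<longleftrightarrow> (\<exists>\<kappa> :: int \<Rightarrow> int \<Rightarrow> real. \<forall>a b c d.
     B $ (a, b) $ (c, d) =
       \<kappa> ((int (pos c) - int (pos a)) mod int CARD('M))
         ((int (pos d) - int (pos b)) mod int CARD('N)))"

text \<open>The columns are pairwise distinct columns of the identity matrix.\<close>

definition downsampling :: "real^'b^'a \<Rightarrow> bool" where
  "downsampling S \<longleftrightarrow> (\<exists>s. inj s \<and> (\<forall>j. column j S = column (s j) (mat 1)))"

definition H_spa ::
    "('M::finite, 'N::finite, 'H::finite, 'm::finite, 'n::finite, 'h::finite, 'l::finite, 'p::finite) data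
     \<Rightarrow> ('M, 'N, 'H) tensor \<Rightarrow> ('m, 'n, 'H) tensor" where
  "H_spa P X = fold3 (unfold3 X ** Blur P ** Down P)"

definition H_spec ::
    "('M::finite, 'N::finite, 'H::finite, 'm::finite, 'n::finite, 'h::finite, 'l::finite, 'p::finite) data
     \<Rightarrow> ('M, 'N, 'H) tensor \<Rightarrow> ('M, 'N, 'h) tensor" where
  "H_spec P X = fold3 (Spec P ** unfold3 X)"

text \<open>The matrix \<open>\<epsilon>\<^sub>i \<epsilon>\<^sub>i\<^sup>T\<close>.\<close>

definition eps_outer :: "'a::finite \<Rightarrow> real^'a^'a" where
  "eps_outer i = (\<chi> a. \<chi> b. axis i 1 $ a * axis i 1 $ b)"

definition J_op ::
    "('M::finite, 'N::finite, 'H::finite, 'm::finite, 'n::finite, 'h::finite, 'l::finite, 'p::finite) data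
     \<Rightarrow> real^'H^'p \<Rightarrow> ('m, 'n, 'H) tensor" where
  "J_op P \<Delta> = fold3 (transpose (\<Sum>i\<in>UNIV. Jac P i ** \<Delta> ** eps_outer i))"

text \<open>Residuals of the two constraints of the convex problem.\<close>

definition res1 ::
    "('M::finite, 'N::finite, 'H::finite, 'm::finite, 'n::finite, 'h::finite, 'l::finite, 'p::finite) data
     \<Rightarrow> ('M, 'N, 'l) tensor \<Rightarrow> real^'H^'p \<Rightarrow> ('m, 'n, 'H) tensor" where
  "res1 P L \<Delta> = H_spa P (L \<times>\<^sub>3 Dict P) - (Ywarp P + J_op P \<Delta>)"

definition res2 ::
    "('M::finite, 'N::finite, 'H::finite, 'm::finite, 'n::finite, 'h::finite, 'l::finite, 'p::finite) data
     \<Rightarrow> ('M, 'N, 'l) tensor \<Rightarrow> real^'h^'h \<Rightarrow> ('M, 'N, 'h) tensor \<Rightarrow> ('M, 'N, 'h) tensor" where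
  "res2 P L A B = H_spec P (L \<times>\<^sub>3 Dict P) - (Zdata P \<times>\<^sub>3 A + B)"


section \<open>The convex problem and its Lagrangian dual\<close>

definition primal_feasible ::
    "('M::finite, 'N::finite, 'H::finite, 'm::finite, 'n::finite, 'h::finite, 'l::finite, 'p::finite) data
     \<Rightarrow> ('M, 'N, 'l) tensor \<times> (real^'H^'p) \<times> (real^'h^'h) \<times> ('M, 'N, 'h) tensor \<Rightarrow> bool" where
  "primal_feasible P = (\<lambda>(L, \<Delta>, A, B).
     H_spa P (L \<times>\<^sub>3 Dict P) = Ywarp P + J_op P \<Delta> \<and>
     H_spec P (L \<times>\<^sub>3 Dict P) = Zdata P \<times>\<^sub>3 A + B)"

definition primal_optimal ::
    "('M::finite, 'N::finite, 'H::finite, 'm::finite, 'n::finite, 'h::finite, 'l::{finite, linorder}, 'p::finite) data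
     \<Rightarrow> ('M, 'N, 'l) tensor \<times> (real^'H^'p) \<times> (real^'h^'h) \<times> ('M, 'N, 'h) tensor \<Rightarrow> bool" where
  "primal_optimal P = is_arg_min (\<lambda>(L, \<Delta>, A, B). tnn L) (primal_feasible P)"

definition lagrangian ::
    "('M::finite, 'N::finite, 'H::finite, 'm::finite, 'n::finite, 'h::finite, 'l::{finite, linorder}, 'p::finite) data
     \<Rightarrow> ('M, 'N, 'l) tensor \<times> (real^'H^'p) \<times> (real^'h^'h) \<times> ('M, 'N, 'h) tensor
     \<Rightarrow> ('m, 'n, 'H) tensor \<times> ('M, 'N, 'h) tensor \<Rightarrow> real" where
  "lagrangian P = (\<lambda>(L, \<Delta>, A, B) (O1, O2).
     tnn L + O1 \<bullet> (H_spa P (L \<times>\<^sub>3 Dict P) - Ywarp P - J_op P \<Delta>)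
           + O2 \<bullet> (H_spec P (L \<times>\<^sub>3 Dict P) - Zdata P \<times>\<^sub>3 A - B))"

text \<open>Extended-real valued, since the infimum is \<open>-\<infinity>\<close> for many multipliers.\<close>

definition dual_function ::
    "('M::finite, 'N::finite, 'H::finite, 'm::finite, 'n::finite, 'h::finite, 'l::{finite, linorder}, 'p::finite) data
     \<Rightarrow> ('m, 'n, 'H) tensor \<times> ('M, 'N, 'h) tensor \<Rightarrow> ereal" where
  "dual_function P y = (INF x. ereal (lagrangian P x y))"

definition dual_optimal ::
    "('M::finite, 'N::finite, 'H::finite, 'm::finite, 'n::finite, 'h::finite, 'l::{finite, linorder}, 'p::finite) data
     \<Rightarrow> ('m, 'n, 'H) tensor \<times> ('M, 'N, 'h) tensor \<Rightarrow> bool" where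
  "dual_optimal P = is_arg_max (dual_function P) (\<lambda>_. True)"


section \<open>The algorithm\<close>

definition aug_lagrangian ::
    "('M::finite, 'N::finite, 'H::finite, 'm::finite, 'n::finite, 'h::finite, 'l::{finite, linorder}, 'p::finite) data
     \<Rightarrow> real \<Rightarrow> real \<Rightarrow> ('M, 'N, 'l) tensor \<Rightarrow> real^'H^'p \<Rightarrow> real^'h^'h \<Rightarrow> ('M, 'N, 'h) tensor
     \<Rightarrow> ('m, 'n, 'H) tensor \<Rightarrow> ('M, 'N, 'h) tensor \<Rightarrow> real" where
  "aug_lagrangian P \<mu>1 \<mu>2 L \<Delta> A B O1 O2 =
     tnn L + \<mu>1 / 2 * (norm (res1 P L \<Delta> + (1 / \<mu>1) *\<^sub>R O1))\<^sup>2
           + \<mu>2 / 2 * (norm (res2 P L A B + (1 / \<mu>2) *\<^sub>R O2))\<^sup>2"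

text \<open>
  The minimizers in \<open>\<Delta>\<tau>\<close> and \<open>(A, B)\<close> need not be unique; these are the least-squares solutions
  selected by the pseudoinverse.
\<close>

definition dtau_ls ::
    "('M::finite, 'N::finite, 'H::finite, 'm::finite, 'n::finite, 'h::finite, 'l::finite, 'p::finite) data
     \<Rightarrow> real \<Rightarrow> ('M, 'N, 'l) tensor \<Rightarrow> ('m, 'n, 'H) tensor \<Rightarrow> real^'H^'p" where
  "dtau_ls P \<mu>1 L O1 = (\<Sum>i\<in>UNIV. pinv (Jac P i) **
     transpose (unfold3 (H_spa P (L \<times>\<^sub>3 Dict P) + (1 / \<mu>1) *\<^sub>R O1 - Ywarp P)) ** eps_outer i)"

definition AB_ls ::
    "('M::finite, 'N::finite, 'H::finite, 'm::finite, 'n::finite, 'h::finite, 'l::finite, 'p::finite) data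
     \<Rightarrow> real \<Rightarrow> ('M, 'N, 'l) tensor \<Rightarrow> ('M, 'N, 'h) tensor \<Rightarrow> real^('h + 'M \<times> 'N)^'h" where
  "AB_ls P \<mu>2 L O2 =
     (Spec P ** Dict P ** unfold3 L + (1 / \<mu>2) *\<^sub>R unfold3 O2) ** pinv (vcat (unfold3 (Zdata P)) (mat 1))"

text \<open>\<open>\<Delta>half t\<close> is the intermediate iterate with index \<open>t + 1/2\<close>.\<close>

definition sgs_admm ::
    "('M::finite, 'N::finite, 'H::finite, 'm::finite, 'n::finite, 'h::finite, 'l::{finite, linorder}, 'p::finite) data
     \<Rightarrow> real \<Rightarrow> real \<Rightarrow> real
     \<Rightarrow> (nat \<Rightarrow> ('M, 'N, 'l) tensor) \<Rightarrow> (nat \<Rightarrow> real^'H^'p) \<Rightarrow> (nat \<Rightarrow> real^'H^'p)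
     \<Rightarrow> (nat \<Rightarrow> real^'h^'h) \<Rightarrow> (nat \<Rightarrow> ('M, 'N, 'h) tensor)
     \<Rightarrow> (nat \<Rightarrow> ('m, 'n, 'H) tensor) \<Rightarrow> (nat \<Rightarrow> ('M, 'N, 'h) tensor) \<Rightarrow> bool" where
  "sgs_admm P \<mu>1 \<mu>2 \<rho> L \<Delta>half \<Delta> A B O1 O2 \<longleftrightarrow> (\<forall>t.
     is_arg_min (\<lambda>x. aug_lagrangian P \<mu>1 \<mu>2 (L t) x (A t) (B t) (O1 t) (O2 t))
       (\<lambda>_. True) (\<Delta>half t) \<and>
     \<Delta>half t = dtau_ls P \<mu>1 (L t) (O1 t) \<and>
     is_arg_min (\<lambda>x. aug_lagrangian P \<mu>1 \<mu>2 x (\<Delta>half t) (A t) (B t) (O1 t) (O2 t))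
       (\<lambda>_. True) (L (Suc t)) \<and>
     is_arg_min (\<lambda>x. aug_lagrangian P \<mu>1 \<mu>2 (L (Suc t)) x (A t) (B t) (O1 t) (O2 t))
       (\<lambda>_. True) (\<Delta> (Suc t)) \<and>
     \<Delta> (Suc t) = dtau_ls P \<mu>1 (L (Suc t)) (O1 t) \<and>
     is_arg_min (\<lambda>(X, Y). aug_lagrangian P \<mu>1 \<mu>2 (L (Suc t)) (\<Delta> (Suc t)) X Y (O1 t) (O2 t))
       (\<lambda>_. True) (A (Suc t), B (Suc t)) \<and>
     hcat (A (Suc t)) (unfold3 (B (Suc t))) = AB_ls P \<mu>2 (L (Suc t)) (O2 t) \<and>
     O1 (Suc t) = O1 t + (\<rho> * \<mu>1) *\<^sub>R res1 P (L (Suc t)) (\<Delta> (Suc t)) \<and>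
     O2 (Suc t) = O2 t + (\<rho> * \<mu>2) *\<^sub>R res2 P (L (Suc t)) (A (Suc t)) (B (Suc t)))"

end

theory Submission
  imports Defs
begin

text \<open>
  The nuclear norm of \<open>A\<close> is the maximum of \<open>U \<bullet> A\<close> over all contractions \<open>U\<close>, so it is a norm that
  dominates the Frobenius norm; as the Fourier transform is injective, the tensor nuclear norm
  is convex and coercive.

  Let \<open>Pr\<close> be the orthogonal projection onto the range of the Jacobian operator and
  \<open>Q = 1 - Pr\<close>. Minimizing exactly over \<open>\<Delta>\<tau>\<close> and over \<open>(A, B)\<close> eliminates these
  blocks: \<open>Pr O1\<close> and \<open>O2\<close> are multiplied by \<open>1 - \<rho>\<close> in each iteration, and
  \<open>(L, Q O1)\<close> follows a proximal method of multipliers for the single constraint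
  \<open>Q (K L - Y) = 0\<close>, where \<open>K L\<close> is the spatial observation and \<open>Y\<close> the warped image,
  with proximal terms \<open>Pr (K (L - L t))\<close> and \<open>W (L - L t)\<close>, \<open>W\<close> being the spectral observation.
  The usual quadratic Lyapunov function for this method decreases as soon as \<open>\<rho> < 2\<close>.
  Together with coercivity this gives a cluster point, which satisfies the KKT conditions;
  taking it as the reference point of the Lyapunov function shows that \<open>O1\<close>, \<open>O2\<close>, \<open>K L\<close> and
  \<open>W L\<close> converge. \<open>\<Delta>\<tau>\<close>, \<open>A\<close> and \<open>B\<close> are continuous functions of these by the least-squares
  formulas. Every cluster point of \<open>L\<close> is optimal together with their limits, so there is only one,
  because the other blocks of a solution are assumed to determine \<open>L\<close>.
\<close>

section \<open>The nuclear norm\<close>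

text \<open>The library inner product on complex vectors is real-valued. The Hermitian form is
  needed because the multiplicities in \<open>nuclear_norm\<close> are complex dimensions, so
  eigenvectors have to be orthonormal over the complex numbers.\<close>

definition cinner :: "complex^'n \<Rightarrow> complex^'n \<Rightarrow> complex" where
  "cinner x y = (\<Sum>i\<in>UNIV. cnj (x $ i) * y $ i)"

lemma Re_cinner: "Re (cinner x y) = x \<bullet> y"
  by (simp add: cinner_def inner_vec_def inner_complex_def)

lemma cinner_commute: "cinner y x = cnj (cinner x y)"
  by (simp add: cinner_def mult.commute)

lemma cinner_self: "cinner x x = complex_of_real ((norm x)\<^sup>2)"
proof -
  have "Im (cinner x x) = 0" by (simp add: cinner_def)
  moreover have "Re (cinner x x) = (norm x)\<^sup>2"
    by (simp add: Re_cinner power2_norm_eq_inner)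
  ultimately show ?thesis by (simp add: complex_eq_iff)
qed

lemma cinner_add_right: "cinner x (y + z) = cinner x y + cinner x z"
  by (simp add: cinner_def ring_distribs sum.distrib)

lemma cinner_diff_right: "cinner x (y - z) = cinner x y - cinner x z"
  by (simp add: cinner_def ring_distribs sum_subtractf)

lemma cinner_scale_right: "cinner x (c *s y) = c * cinner x y"
  by (simp add: cinner_def sum_distrib_left mult.left_commute)

lemma cinner_scale_left: "cinner (c *s x) y = cnj c * cinner x y"
  by (simp add: cinner_def sum_distrib_left mult.assoc)

lemma cnj_mult_self: "cnj c * c = complex_of_real ((cmod c)\<^sup>2)"
  by (simp only: complex_norm_square mult.commute)

lemma cinner_zero_right [simp]: "cinner x 0 = 0"
  by (simp add: cinner_def)

lemma cinner_sum_right: "cinner x (\<Sum>i\<in>I. f i) = (\<Sum>i\<in>I. cinner x (f i))"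
  by (induction I rule: infinite_finite_induct) (simp_all add: cinner_add_right)

lemma cinner_sum_left: "cinner (\<Sum>i\<in>I. f i) x = (\<Sum>i\<in>I. cinner (f i) x)"
  by (subst cinner_commute) (simp add: cinner_sum_right cinner_commute [of _ x])

lemma cinner_ctranspose: "cinner x (ctranspose A *v y) = cinner (A *v x) y"
  unfolding cinner_def matrix_vector_mult_def ctranspose_def
  by (simp add: sum_distrib_left sum_distrib_right, subst sum.swap) (simp add: ac_simps)

lemma cinner_gram: "cinner x ((ctranspose A ** A) *v y) = cinner (A *v x) (A *v y)"
  by (simp add: cinner_ctranspose flip: matrix_vector_mul_assoc)

lemma norm_scale_complex: "norm (c *s (x :: complex^'n)) = cmod c * norm x"
proof -
  have "complex_of_real ((norm (c *s x))\<^sup>2) = complex_of_real ((cmod c * norm x)\<^sup>2)"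
    by (simp only: cinner_self [symmetric] cinner_scale_left cinner_scale_right
        power_mult_distrib of_real_mult cnj_mult_self [symmetric] mult_ac)
  then have "(norm (c *s x))\<^sup>2 = (cmod c * norm x)\<^sup>2" using of_real_eq_iff by blast
  then show ?thesis by (simp add: power2_eq_iff_nonneg)
qed

lemma scale_of_real: "complex_of_real c *s x = c *\<^sub>R (x :: complex^'n)"
  by (simp add: vec_eq_iff) (simp add: scaleR_conv_of_real)

text \<open>Pythagoras, for vectors that need not be normalized: it is applied to left singular
  vectors that are zero where \<open>A\<close> vanishes.\<close>

lemma norm_sum_orthogonal:
  fixes b :: "'a \<Rightarrow> complex^'n"
  assumes "finite V" and "\<And>v w. v \<in> V \<Longrightarrow> w \<in> V \<Longrightarrow> v \<noteq> w \<Longrightarrow> cinner (b v) (b w) = 0"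
  shows "(norm (\<Sum>v\<in>V. c v *s b v))\<^sup>2 = (\<Sum>v\<in>V. (cmod (c v))\<^sup>2 * (norm (b v))\<^sup>2)"
proof -
  have "complex_of_real ((norm (\<Sum>v\<in>V. c v *s b v))\<^sup>2)
      = (\<Sum>v\<in>V. \<Sum>w\<in>V. cnj (c w) * (c v * cinner (b w) (b v)))"
    by (simp only: cinner_self [symmetric] cinner_sum_right cinner_sum_left
        cinner_scale_left cinner_scale_right mult.left_commute sum_distrib_left)
  also have "\<dots> = (\<Sum>v\<in>V. \<Sum>w\<in>V. if w = v then complex_of_real ((cmod (c v))\<^sup>2 * (norm (b v))\<^sup>2) else 0)"
    by (intro sum.cong refl) (auto simp: assms(2) cinner_self cnj_mult_self simp del: of_real_power simp flip: mult.assoc)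
  also have "\<dots> = complex_of_real (\<Sum>v\<in>V. (cmod (c v))\<^sup>2 * (norm (b v))\<^sup>2)"
    using assms(1) by simp
  finally show ?thesis using of_real_eq_iff by blast
qed

text \<open>Divide by \<open>s\<close> and let \<open>s\<close> tend to 0 from the right. This turns
  every minimality along a segment below into a first-order condition.\<close>

lemma quadratic_nonneg_imp_linear_nonneg:
  fixes a b :: real
  assumes "\<And>s. 0 < s \<Longrightarrow> s \<le> 1 \<Longrightarrow> 0 \<le> s * a + s\<^sup>2 * b"
  shows "0 \<le> a"
proof -
  have "((\<lambda>s. a + s * b) \<longlongrightarrow> a + 0 * b) (at_right 0)" by (intro tendsto_intros)
  moreover have "\<forall>\<^sub>F s in at_right (0::real). 0 \<le> a + s * b"
    unfolding eventually_at_right_field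
  proof (intro exI [of _ 1] conjI allI impI)
    fix s :: real assume s: "0 < s" "s < 1"
    have "s * (a + s * b) = s * a + s\<^sup>2 * b" by (simp add: power2_eq_square algebra_simps)
    then have "0 \<le> s * (a + s * b)" using assms [of s] s by simp
    then show "0 \<le> a + s * b" using s(1) by (simp add: zero_le_mult_iff)
  qed simp
  ultimately have "0 \<le> a + 0 * b" by (rule tendsto_lowerbound) simp
  then show ?thesis by simp
qed

text \<open>The eigenvector is a maximizer of the Rayleigh quotient on the unit sphere of \<open>W\<close>.\<close>

lemma selfadjoint_eigenvector_exists:
  fixes T :: "'a::euclidean_space \<Rightarrow> 'a"
  assumes T: "linear T" and W: "subspace W" "w \<in> W" "w \<noteq> 0"
    and inv: "\<And>x. x \<in> W \<Longrightarrow> T x \<in> W"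
    and sym: "\<And>x y. x \<bullet> T y = T x \<bullet> y"
  obtains x c where "x \<in> W" "norm x = 1" "T x = c *\<^sub>R x"
proof -
  interpret T: linear T by fact
  define S where "S = W \<inter> sphere 0 1"
  have "compact S" unfolding S_def
    by (metis W(1) closed_Int_compact closed_subspace compact_sphere)
  moreover have "inverse (norm w) *\<^sub>R w \<in> S"
    using W by (simp add: S_def subspace_scale)
  moreover have "continuous_on S (\<lambda>x. x \<bullet> T x)"
    using T by (intro continuous_intros linear_continuous_on) (simp add: linear_conv_bounded_linear)
  ultimately obtain x where x: "x \<in> S" and max: "\<And>y. y \<in> S \<Longrightarrow> y \<bullet> T y \<le> x \<bullet> T x"
    using continuous_attains_sup [of S "\<lambda>x. x \<bullet> T x"] by blast
  define c where "c = x \<bullet> T x"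
  have xW: "x \<in> W" and nx: "norm x = 1" using x by (auto simp: S_def)
  have form: "0 \<le> c * (y \<bullet> y) - y \<bullet> T y" if y: "y \<in> W" for y
  proof (cases "y = 0")
    case False
    have "inverse (norm y) *\<^sub>R y \<in> S" using y False W by (simp add: S_def subspace_scale)
    from max [OF this] have "inverse (norm y) * (inverse (norm y) * (y \<bullet> T y)) \<le> c"
      by (simp add: c_def T.scaleR)
    with False have "y \<bullet> T y \<le> c * (norm y)\<^sup>2"
      by (simp add: field_simps power2_eq_square)
    then show ?thesis by (simp add: power2_norm_eq_inner)
  qed (simp add: T.zero)
  \<comment> \<open>The form \<open>c * (y \<bullet> y) - y \<bullet> T y\<close> is nonnegative on
    \<open>W\<close> and vanishes at \<open>x\<close>, where its gradient is twice \<open>d\<close>.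
    Moving from \<open>x\<close> in direction \<open>- d\<close> would make it negative unless
    \<open>d = 0\<close>.\<close>
  define d where "d = c *\<^sub>R x - T x"
  have dW: "d \<in> W" using W inv xW by (simp add: d_def subspace_diff subspace_scale)
  have "0 \<le> s * (- 2 * (d \<bullet> d)) + s\<^sup>2 * (c * (d \<bullet> d) - d \<bullet> T d)" for s
  proof -
    have "x - s *\<^sub>R d \<in> W" using W xW dW by (simp add: subspace_diff subspace_scale)
    then have "0 \<le> c * ((x - s *\<^sub>R d) \<bullet> (x - s *\<^sub>R d)) - (x - s *\<^sub>R d) \<bullet> T (x - s *\<^sub>R d)"
      by (rule form)
    moreover have "(x - s *\<^sub>R d) \<bullet> (x - s *\<^sub>R d) = 1 - 2 * s * (d \<bullet> x) + s\<^sup>2 * (d \<bullet> d)"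
      using nx by (simp add: norm_eq_1 inner_diff_left inner_diff_right inner_commute [of x d]
          power2_eq_square algebra_simps)
    moreover have "(x - s *\<^sub>R d) \<bullet> T (x - s *\<^sub>R d) = c - 2 * s * (d \<bullet> T x) + s\<^sup>2 * (d \<bullet> T d)"
      by (simp add: T.diff T.scaleR c_def inner_diff_left inner_diff_right sym [of x d]
          inner_commute [of "T x" d] power2_eq_square algebra_simps)
    moreover have "d \<bullet> T x = c * (d \<bullet> x) - d \<bullet> d"
    proof -
      have "T x = c *\<^sub>R x - d" by (simp add: d_def)
      then show ?thesis by (simp only: inner_diff_right inner_scaleR_right)
    qed
    ultimately have "0 \<le> c * (1 - 2 * s * (d \<bullet> x) + s\<^sup>2 * (d \<bullet> d))
        - (c - 2 * s * (c * (d \<bullet> x) - d \<bullet> d) + s\<^sup>2 * (d \<bullet> T d))" by simp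
    also have "\<dots> = s * (- 2 * (d \<bullet> d)) + s\<^sup>2 * (c * (d \<bullet> d) - d \<bullet> T d)" by algebra
    finally show ?thesis .
  qed
  then have "0 \<le> - 2 * (d \<bullet> d)" by (rule quadratic_nonneg_imp_linear_nonneg)
  then have "d = 0" using inner_ge_zero [of d] by simp
  then show thesis using that [of x c] xW nx by (simp add: d_def)
qed

section \<open>Orthonormal eigenbases of the Gram matrix\<close>

definition corthonormal :: "(complex^'n) set \<Rightarrow> bool" where
  "corthonormal V \<longleftrightarrow> (\<forall>v\<in>V. \<forall>w\<in>V. cinner v w = (if v = w then 1 else 0))"

lemma corthonormalD: "corthonormal V \<Longrightarrow> v \<in> V \<Longrightarrow> w \<in> V \<Longrightarrow> cinner v w = (if v = w then 1 else 0)"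
  by (auto simp: corthonormal_def)

lemma corthonormal_norm: "corthonormal V \<Longrightarrow> v \<in> V \<Longrightarrow> norm v = 1"
  using corthonormalD [of V v v] cinner_self [of v]
  by (metis norm_ge_zero of_real_eq_1_iff one_power2 power2_eq_iff_nonneg zero_le_one)

lemma corthonormal_coeff:
  assumes "corthonormal V" "finite V" "w \<in> V"
  shows "cinner w (\<Sum>v\<in>V. c v *s v) = c w"
proof -
  have "cinner w (\<Sum>v\<in>V. c v *s v) = (\<Sum>v\<in>V. if v = w then c v else 0)"
    unfolding cinner_sum_right cinner_scale_right using assms by (intro sum.cong refl) (auto simp: corthonormalD)
  then show ?thesis using assms by simp
qed

lemma corthonormal_subset: "corthonormal V \<Longrightarrow> U \<subseteq> V \<Longrightarrow> corthonormal U"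
  unfolding corthonormal_def by blast

lemma corthonormal_imp_independent:
  assumes V: "corthonormal V"
  shows "vec.independent V"
  unfolding vec.dependent_explicit
proof safe
  fix U c v assume U: "finite U" "U \<subseteq> V" and s: "(\<Sum>v\<in>U. c v *s v) = 0" and v: "v \<in> U" "c v \<noteq> 0"
  have "c v = cinner v (\<Sum>v\<in>U. c v *s v)"
    using corthonormal_coeff [OF corthonormal_subset [OF V U(2)] U(1) v(1)] by simp
  then show False using s v by simp
qed

text \<open>These are the right singular vectors of \<open>A\<close>. A unit eigenvector
  \<open>v\<close> of the Gram matrix has the squared norm of \<open>A *v v\<close> as its
  eigenvalue; writing the eigenvalue in this way makes the singular values available as
  \<open>norm (A *v v)\<close>.\<close>

definition eigenbasis :: "complex^'n^'m \<Rightarrow> (complex^'n) set \<Rightarrow> bool" where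
  "eigenbasis A V \<longleftrightarrow> finite V \<and> corthonormal V \<and>
     (\<forall>v\<in>V. (ctranspose A ** A) *v v = complex_of_real ((norm (A *v v))\<^sup>2) *s v) \<and>
     (\<forall>x. x = (\<Sum>v\<in>V. cinner v x *s v))"

text \<open>Orthonormal sets of eigenvectors are independent, hence of bounded size, so there is a
  largest one. Its orthogonal complement is invariant under the Gram matrix; a nonzero complement
  would contain a further unit eigenvector, against maximality.\<close>

lemma eigenbasis_exists: "\<exists>V. eigenbasis A V"
proof -
  define M where "M = ctranspose A ** A"
  define good where "good V \<longleftrightarrow> corthonormal V \<and>
     (\<forall>v\<in>V. M *v v = complex_of_real ((norm (A *v v))\<^sup>2) *s v)" for V
  have fin: "finite V \<and> card V \<le> CARD('a)" if "good V" for V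
  proof -
    have "vec.independent V" using that by (simp add: good_def corthonormal_imp_independent)
    then show ?thesis
      using vec.finiteI_independent vec.dim_eq_card_independent vec.dim_subset [of V UNIV] vec_dim_card
      by (metis subset_UNIV)
  qed
  have "good {}" by (simp add: good_def corthonormal_def)
  then obtain V where V: "good V" and max: "\<And>U. good U \<Longrightarrow> card U \<le> card V"
    using ex_has_greatest_nat [of good "{}" card] fin by (metis less_Suc_eq_le)
  have finV: "finite V" using fin V by blast
  have ortho: "corthonormal V" using V by (simp add: good_def)
  have complete: "w = 0" if w: "\<And>v. v \<in> V \<Longrightarrow> cinner v w = 0" for w
  proof (rule ccontr)
    assume "w \<noteq> 0"
    define W where "W = {w. \<forall>v\<in>V. cinner v w = 0}"
    \<comment> \<open>\<open>W\<close> is regarded as a real subspace, to which the real eigenvector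
      lemma applies. The eigenvalue obtained is real, so the equation is also one over the complex
      numbers.\<close>
    have sub: "subspace W"
      by (auto simp: W_def subspace_def cinner_add_right cinner_scale_right simp flip: scale_of_real)
    have inv: "M *v x \<in> W" if "x \<in> W" for x
    proof -
      have "cinner v (M *v x) = 0" if v: "v \<in> V" for v
      proof -
        have "cinner v (M *v x) = cnj (cinner x (M *v v))"
          unfolding M_def cinner_gram by (simp add: cinner_commute [of "A *v x"])
        also have "\<dots> = 0"
          using V v \<open>x \<in> W\<close> cinner_commute [of x v]
          by (simp add: good_def cinner_scale_right W_def)
        finally show ?thesis .
      qed
      then show ?thesis by (simp add: W_def)
    qed
    have sym: "x \<bullet> (M *v y) = (M *v x) \<bullet> y" for x y
      by (metis M_def Re_cinner cinner_gram inner_commute)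
    have lin: "linear ((*v) M)"
      by (rule linearI) (simp_all add: matrix_vector_right_distrib vec.scale flip: scale_of_real)
    have "w \<in> W" using w by (simp add: W_def)
    obtain x c where x: "x \<in> W" "norm x = 1" "M *v x = c *\<^sub>R x"
      using selfadjoint_eigenvector_exists [OF lin sub \<open>w \<in> W\<close> \<open>w \<noteq> 0\<close> inv sym] by blast
    have xx: "cinner x x = 1" using x by (simp add: cinner_self)
    have "complex_of_real ((norm (A *v x))\<^sup>2) = cinner x (M *v x)"
      by (simp add: M_def cinner_gram cinner_self)
    also have "\<dots> = complex_of_real c" by (simp add: x xx cinner_scale_right flip: scale_of_real)
    finally have "M *v x = complex_of_real ((norm (A *v x))\<^sup>2) *s x"
      by (simp add: x scale_of_real)
    moreover have "cinner v x = 0" "cinner x v = 0" if "v \<in> V" for v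
      using x that cinner_commute [of x v] by (auto simp: W_def)
    moreover have "x \<notin> V" using x xx by (auto simp: W_def)
    ultimately have "good (insert x V)"
      using V xx unfolding good_def corthonormal_def by auto
    from max [OF this] show False using finV \<open>x \<notin> V\<close> by simp
  qed
  have "x = (\<Sum>v\<in>V. cinner v x *s v)" for x
    using complete [of "x - (\<Sum>v\<in>V. cinner v x *s v)"]
    by (simp add: cinner_diff_right corthonormal_coeff [OF ortho finV])
  then show ?thesis using V finV unfolding eigenbasis_def good_def M_def by blast
qed

section \<open>Singular values read off from an eigenbasis\<close>

text \<open>Eigenvectors of a self-adjoint matrix for different eigenvalues are orthogonal, so the
  expansion of a vector of \<open>sv_space A \<sigma>\<close> involves only basis vectors with the
  same eigenvalue.\<close>

lemma sv_space_eq_span: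
  assumes "eigenbasis A V"
  shows "sv_space A \<sigma> = vec.span {v\<in>V. (norm (A *v v))\<^sup>2 = \<sigma>\<^sup>2}"
proof safe
  define M where "M = ctranspose A ** A"
  fix x assume "x \<in> sv_space A \<sigma>"
  then have x: "M *v x = complex_of_real (\<sigma>\<^sup>2) *s x" by (simp add: sv_space_def M_def)
  have "cinner v x = 0" if v: "v \<in> V" "(norm (A *v v))\<^sup>2 \<noteq> \<sigma>\<^sup>2" for v
  proof -
    have "complex_of_real (\<sigma>\<^sup>2) * cinner v x = cinner v (M *v x)"
      by (simp add: x cinner_scale_right)
    also have "\<dots> = cnj (cinner x (M *v v))"
      unfolding M_def cinner_gram by (simp add: cinner_commute [of "A *v x"])
    also have "\<dots> = complex_of_real ((norm (A *v v))\<^sup>2) * cinner v x"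
      using assms v cinner_commute [of x v] by (simp add: eigenbasis_def M_def cinner_scale_right)
    finally show ?thesis using v(2) by (metis mult_right_cancel of_real_eq_iff)
  qed
  then have "(\<Sum>v\<in>V. cinner v x *s v) = (\<Sum>v\<in>{v\<in>V. (norm (A *v v))\<^sup>2 = \<sigma>\<^sup>2}. cinner v x *s v)"
    using assms by (intro sum.mono_neutral_right) (auto simp: eigenbasis_def)
  then have "x = (\<Sum>v\<in>{v\<in>V. (norm (A *v v))\<^sup>2 = \<sigma>\<^sup>2}. cinner v x *s v)"
    using assms unfolding eigenbasis_def by metis
  moreover have "\<dots> \<in> vec.span {v\<in>V. (norm (A *v v))\<^sup>2 = \<sigma>\<^sup>2}"
    by (intro vec.span_sum vec.span_scale vec.span_base)
  ultimately show "x \<in> vec.span {v\<in>V. (norm (A *v v))\<^sup>2 = \<sigma>\<^sup>2}" by simp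
next
  fix x assume "x \<in> vec.span {v\<in>V. (norm (A *v v))\<^sup>2 = \<sigma>\<^sup>2}"
  moreover have "vec.subspace (sv_space A \<sigma>)"
    by (rule vec.subspaceI) (auto simp: sv_space_def matrix_vector_right_distrib vec.scale
        vec.scale_right_distrib vector_smult_assoc mult.commute)
  moreover have "{v\<in>V. (norm (A *v v))\<^sup>2 = \<sigma>\<^sup>2} \<subseteq> sv_space A \<sigma>"
    using assms by (auto simp: sv_space_def eigenbasis_def simp del: of_real_power)
  ultimately show "x \<in> sv_space A \<sigma>" using vec.span_minimal by blast
qed

lemma dim_sv_space:
  assumes "eigenbasis A V" and "0 \<le> \<sigma>"
  shows "vec.dim (sv_space A \<sigma>) = card {v\<in>V. norm (A *v v) = \<sigma>}"
proof -
  have "vec.independent {v\<in>V. (norm (A *v v))\<^sup>2 = \<sigma>\<^sup>2}"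
    using assms by (intro corthonormal_imp_independent)
      (auto simp: eigenbasis_def intro: corthonormal_subset)
  then have "vec.dim (sv_space A \<sigma>) = card {v\<in>V. (norm (A *v v))\<^sup>2 = \<sigma>\<^sup>2}"
    unfolding sv_space_eq_span [OF assms(1)] vec.dim_span by (rule vec.dim_eq_card_independent)
  also have "{v\<in>V. (norm (A *v v))\<^sup>2 = \<sigma>\<^sup>2} = {v\<in>V. norm (A *v v) = \<sigma>}"
    using assms(2) by (auto simp: power2_eq_iff_nonneg)
  finally show ?thesis .
qed

lemma singular_values_eq:
  assumes V: "eigenbasis A V"
  shows "singular_values A = (\<lambda>v. norm (A *v v)) ` V - {0}"
proof (intro equalityI subsetI)
  fix \<sigma> assume "\<sigma> \<in> singular_values A"
  then obtain x where \<sigma>: "\<sigma> > 0" and x: "x \<in> sv_space A \<sigma>" "x \<noteq> 0"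
    by (auto simp: singular_values_def)
  have "{v\<in>V. (norm (A *v v))\<^sup>2 = \<sigma>\<^sup>2} \<noteq> {}"
  proof
    assume "{v\<in>V. (norm (A *v v))\<^sup>2 = \<sigma>\<^sup>2} = {}"
    then show False using x by (simp only: sv_space_eq_span [OF V]) (simp add: vec.span_empty)
  qed
  then show "\<sigma> \<in> (\<lambda>v. norm (A *v v)) ` V - {0}"
    using \<sigma> by (auto simp: power2_eq_iff_nonneg)
next
  fix \<sigma> assume "\<sigma> \<in> (\<lambda>v. norm (A *v v)) ` V - {0}"
  then obtain v where v: "v \<in> V" "\<sigma> = norm (A *v v)" "\<sigma> \<noteq> 0" by auto
  have "cinner v v = 1" using V v by (simp add: eigenbasis_def corthonormal_def)
  then have "v \<noteq> 0" by auto
  moreover have "v \<in> sv_space A \<sigma>" using V v by (simp add: eigenbasis_def sv_space_def)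
  ultimately show "\<sigma> \<in> singular_values A" using v by (auto simp: singular_values_def)
qed

text \<open>Group the basis by the value of \<open>norm (A *v v)\<close>. The size of each group is
  the multiplicity, and the group of value 0, absent from \<open>singular_values\<close>,
  contributes nothing.\<close>

lemma nuclear_norm_eq_sum:
  assumes V: "eigenbasis A V"
  shows "nuclear_norm A = (\<Sum>v\<in>V. norm (A *v v))"
proof -
  let ?g = "\<lambda>v. norm (A *v v)"
  have fin: "finite V" using V by (simp add: eigenbasis_def)
  have "nuclear_norm A = (\<Sum>\<sigma>\<in>?g ` V - {0}. real (card {v\<in>V. ?g v = \<sigma>}) * \<sigma>)"
    unfolding nuclear_norm_def singular_values_eq [OF V]
    by (intro sum.cong refl) (auto simp: dim_sv_space [OF V])
  also have "\<dots> = (\<Sum>\<sigma>\<in>?g ` V. real (card {v\<in>V. ?g v = \<sigma>}) * \<sigma>)"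
    using fin by (intro sum.mono_neutral_left) auto
  also have "\<dots> = (\<Sum>\<sigma>\<in>?g ` V. \<Sum>v\<in>{v\<in>V. ?g v = \<sigma>}. ?g v)"
    by (intro sum.cong refl) simp
  also have "\<dots> = (\<Sum>v\<in>V. ?g v)"
    using fin by (rule sum.image_gen [symmetric])
  finally show ?thesis .
qed

text \<open>The real part of the trace of \<open>ctranspose U ** A\<close> is the same in every
  orthonormal basis. The basis may come from a third matrix \<open>B\<close>, and later it is the
  one of \<open>A\<close>.\<close>

lemma inner_matrix_eq_sum:
  fixes A U :: "complex^'n^'m"
  assumes V: "eigenbasis B V"
  shows "U \<bullet> A = (\<Sum>v\<in>V. (U *v v) \<bullet> (A *v v))"
proof -
  have fin: "finite V" using V by (simp add: eigenbasis_def)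
  \<comment> \<open>Completeness in coordinates: expand the \<open>i\<close>-th unit vector and read
    off entry \<open>j\<close>.\<close>
  have delta: "(\<Sum>v\<in>V. cnj (v $ i) * v $ j) = (if i = j then 1 else 0)" for i j :: 'n
  proof -
    have "axis i 1 = (\<Sum>v\<in>V. cinner v (axis i 1) *s v)" using V by (auto simp: eigenbasis_def)
    then have "axis i 1 $ j = (\<Sum>v\<in>V. cinner v (axis i 1) *s v) $ j" by metis
    also have "\<dots> = (\<Sum>v\<in>V. cnj (v $ i) * v $ j)"
      by (auto simp: cinner_def axis_def if_distrib [of "\<lambda>x. _ * x"] cong: if_cong intro!: sum.cong)
    finally show ?thesis by (auto simp: axis_def)
  qed
  have "(\<Sum>v\<in>V. cinner (U *v v) (A *v v))
      = (\<Sum>v\<in>V. \<Sum>k\<in>UNIV. \<Sum>i\<in>UNIV. \<Sum>j\<in>UNIV. cnj (U $ k $ i) * A $ k $ j * (cnj (v $ i) * v $ j))"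
    by (simp add: cinner_def matrix_vector_mult_def sum_product) (simp add: mult_ac)
  also have "\<dots> = (\<Sum>k\<in>UNIV. \<Sum>i\<in>UNIV. \<Sum>j\<in>UNIV. \<Sum>v\<in>V. cnj (U $ k $ i) * A $ k $ j * (cnj (v $ i) * v $ j))"
    by (subst sum.swap, intro sum.cong refl, subst sum.swap, intro sum.cong refl, subst sum.swap) simp
  also have "\<dots> = (\<Sum>k\<in>UNIV. \<Sum>i\<in>UNIV. cnj (U $ k $ i) * A $ k $ i)"
    by (simp add: delta if_distrib [of "\<lambda>x. _ * x"] cong: if_cong flip: sum_distrib_left)
  finally have "Re (\<Sum>v\<in>V. cinner (U *v v) (A *v v)) = Re (\<Sum>k\<in>UNIV. \<Sum>i\<in>UNIV. cnj (U $ k $ i) * A $ k $ i)"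
    by simp
  then show ?thesis by (simp add: Re_cinner inner_vec_def inner_complex_def)
qed

text \<open>The Frobenius norm is the Euclidean norm of the list of singular values, the nuclear
  norm its sum.\<close>

lemma norm_le_nuclear_norm: "norm A \<le> nuclear_norm A"
proof -
  obtain V where V: "eigenbasis A V" using eigenbasis_exists by blast
  have "(norm A)\<^sup>2 = (\<Sum>v\<in>V. (norm (A *v v))\<^sup>2)"
    by (simp add: power2_norm_eq_inner inner_matrix_eq_sum [OF V, of A A])
  then have "norm A = L2_set (\<lambda>v. norm (A *v v)) V" by (simp add: L2_set_def real_sqrt_unique)
  also have "\<dots> \<le> nuclear_norm A" unfolding nuclear_norm_eq_sum [OF V] by (rule L2_set_le_sum) simp
  finally show ?thesis .
qed

section \<open>Duality between contractions and the nuclear norm\<close>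

definition contraction :: "complex^'n^'m \<Rightarrow> bool" where
  "contraction U \<longleftrightarrow> (\<forall>x. norm (U *v x) \<le> norm x)"

text \<open>In an eigenbasis of \<open>A\<close>, Cauchy-Schwarz bounds each term of the trace,
  since \<open>U\<close> does not lengthen unit vectors.\<close>

lemma inner_le_nuclear_norm:
  assumes "contraction U"
  shows "U \<bullet> A \<le> nuclear_norm A"
proof -
  obtain V where V: "eigenbasis A V" using eigenbasis_exists by blast
  have "(U *v v) \<bullet> (A *v v) \<le> norm (A *v v)" if v: "v \<in> V" for v
  proof -
    have "norm v = 1" using V v by (auto simp: eigenbasis_def intro: corthonormal_norm)
    then have "norm (U *v v) \<le> 1" using assms by (metis contraction_def)
    then show ?thesis
      using norm_cauchy_schwarz [of "U *v v" "A *v v"] mult_right_mono [of "norm (U *v v)" 1 "norm (A *v v)"]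
      by simp
  qed
  then show ?thesis unfolding nuclear_norm_eq_sum [OF V] inner_matrix_eq_sum [OF V] by (rule sum_mono)
qed

text \<open>The maximizing contraction is the partial isometry of the polar decomposition.\<close>

lemma nuclear_norm_attained: "\<exists>U. contraction U \<and> U \<bullet> A = nuclear_norm A"
proof -
  obtain V where V: "eigenbasis A V" using eigenbasis_exists by blast
  have fin: "finite V" and ortho: "corthonormal V"
    and expand: "x = (\<Sum>v\<in>V. cinner v x *s v)" for x using V by (auto simp: eigenbasis_def)
  \<comment> \<open>The left singular vectors. Where \<open>A *v v\<close> is 0, so is
    \<open>b v\<close>; hence \<open>U\<close> annihilates the kernel of \<open>A\<close>.\<close>
  define b where "b v = complex_of_real (1 / norm (A *v v)) *s (A *v v)" for v
  define U where "U = (\<chi> k i. \<Sum>v\<in>V. b v $ k * cnj (v $ i))"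
  have Ux: "U *v x = (\<Sum>v\<in>V. cinner v x *s b v)" for x
    unfolding U_def matrix_vector_mult_def cinner_def vec_eq_iff
    by (simp add: sum_distrib_right, subst sum.swap) (simp add: mult_ac)
  have nb: "norm (b v) \<le> 1" for v by (simp add: b_def norm_scale_complex norm_divide)
  have b0: "cinner (b v) (b w) = 0" if "v \<in> V" "w \<in> V" "v \<noteq> w" for v w
  proof -
    have "cinner (A *v v) (A *v w) = cinner v ((ctranspose A ** A) *v w)" by (simp add: cinner_gram)
    also have "\<dots> = 0"
      using V that by (simp add: eigenbasis_def cinner_scale_right corthonormal_def)
    finally show ?thesis by (simp add: b_def cinner_scale_left cinner_scale_right)
  qed
  have "norm (U *v x) \<le> norm x" for x
  proof -
    have "(norm (U *v x))\<^sup>2 = (\<Sum>v\<in>V. (cmod (cinner v x))\<^sup>2 * (norm (b v))\<^sup>2)"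
      unfolding Ux by (rule norm_sum_orthogonal [OF fin b0])
    also have "\<dots> \<le> (\<Sum>v\<in>V. (cmod (cinner v x))\<^sup>2 * (norm v)\<^sup>2)"
    proof (intro sum_mono mult_left_mono)
      fix v assume "v \<in> V"
      then show "(norm (b v))\<^sup>2 \<le> (norm v)\<^sup>2"
        using nb [of v] by (simp add: corthonormal_norm [OF ortho] power_le_one)
    qed simp
    also have "\<dots> = (norm (\<Sum>v\<in>V. cinner v x *s v))\<^sup>2"
      using ortho by (intro norm_sum_orthogonal [symmetric] fin) (simp add: corthonormal_def)
    finally show ?thesis using expand [of x] by (metis norm_ge_zero power2_le_imp_le)
  qed
  then have "contraction U" by (simp add: contraction_def)
  moreover have "U \<bullet> A = nuclear_norm A"
    unfolding nuclear_norm_eq_sum [OF V] inner_matrix_eq_sum [OF V]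
  proof (rule sum.cong [OF refl])
    fix v assume v: "v \<in> V"
    have "U *v v = (\<Sum>w\<in>V. if w = v then b w else 0)"
      unfolding Ux using ortho v by (intro sum.cong refl) (auto simp: corthonormal_def)
    also have "\<dots> = b v" using fin v by simp
    finally show "(U *v v) \<bullet> (A *v v) = norm (A *v v)"
      by (simp add: b_def scale_of_real flip: of_real_divide power2_norm_eq_inner del: of_real_divide)
        (simp add: power2_eq_square)
  qed
  ultimately show ?thesis by blast
qed

text \<open>A contraction that attains the norm of the sum is a competitor for each summand.\<close>

lemma nuclear_norm_add: "nuclear_norm (A + B) \<le> nuclear_norm A + nuclear_norm B"
proof -
  obtain U where "contraction U" "U \<bullet> (A + B) = nuclear_norm (A + B)"
    using nuclear_norm_attained by blast
  then show ?thesis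
    using inner_le_nuclear_norm [of U A] inner_le_nuclear_norm [of U B] by (simp add: inner_add_right)
qed

lemma nuclear_norm_scaleR:
  assumes "0 \<le> c"
  shows "nuclear_norm (c *\<^sub>R A) \<le> c * nuclear_norm A"
proof -
  obtain U where "contraction U" "U \<bullet> (c *\<^sub>R A) = nuclear_norm (c *\<^sub>R A)"
    using nuclear_norm_attained by blast
  then show ?thesis
    using mult_left_mono [OF inner_le_nuclear_norm [of U A] assms] by simp
qed


section \<open>Tensor nuclear norm\<close>

lemma dft_slice_add: "dft_slice (X + Y) k = dft_slice X k + dft_slice Y k"
  by (simp add: dft_slice_def vec_eq_iff ring_distribs sum.distrib)

lemma dft_slice_scaleR: "dft_slice (c *\<^sub>R X) k = c *\<^sub>R dft_slice X k"
  unfolding dft_slice_def vec_eq_iff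
  by (simp add: scaleR_sum_right) (simp add: scaleR_conv_of_real mult.assoc)

text \<open>\<open>pos\<close> is strictly increasing with values below the cardinality, so counting
  gives surjectivity. Sums over the index type become sums over an initial segment, to which the
  geometric series applies.\<close>

lemma bij_betw_pos: "bij_betw pos (UNIV :: 'a::{finite,linorder} set) {..<CARD('a)}"
proof -
  have less: "pos i < pos j" if "i < j" for i j :: 'a
    unfolding pos_def using that by (intro psubset_card_mono) (auto intro: less_trans)
  have "inj (pos :: 'a \<Rightarrow> nat)"
    by (metis injI less less_irrefl linorder_neqE)
  moreover have "pos i < CARD('a)" for i :: 'a
    unfolding pos_def by (rule psubset_card_mono) auto
  ultimately show ?thesis
    by (metis (no_types, lifting) bij_betw_def card_image card_lessThan card_subset_eq finite_lessThan
        image_subsetI lessThan_iff)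
qed

text \<open>Fourier inversion by orthogonality of characters; it serves only to show that the
  transform is injective.\<close>

lemma dft_slice_inverse:
  fixes X :: "('n1::finite, 'n2::finite, 'n3::{finite, linorder}) tensor"
  shows "(\<Sum>k\<in>UNIV. dft_slice X k $ i $ j * cis (2 * pi * real (pos k) * real (pos m) / real CARD('n3)))
    = of_nat CARD('n3) * complex_of_real (X $ i $ j $ m)"
proof -
  define n where "n = CARD('n3)"
  have n: "n > 0" by (simp add: n_def)
  have orth: "(\<Sum>k\<in>(UNIV :: 'n3 set). cis (2 * pi * (real (pos m) - real (pos l)) / n) ^ pos k)
      = (if l = m then of_nat n else 0)" for l
  proof -
    define w where "w = cis (2 * pi * (real (pos m) - real (pos l)) / n)"
    have "(\<Sum>k\<in>(UNIV :: 'n3 set). w ^ pos k) = (\<Sum>k<n. w ^ k)"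
      unfolding n_def by (rule sum.reindex_bij_betw [OF bij_betw_pos])
    also have "\<dots> = (if l = m then of_nat n else 0)"
    proof (cases "l = m")
      case False
      have "pos m \<noteq> pos l" "pos m < n" "pos l < n"
        using bij_betw_pos [where 'a = 'n3] False by (auto simp: bij_betw_def inj_eq n_def)
      \<comment> \<open>Otherwise \<open>n\<close> would divide the difference of two distinct
        positions below \<open>n\<close>.\<close>
      have "w \<noteq> 1"
      proof
        assume "w = 1"
        then have "cos (2 * pi * (real (pos m) - real (pos l)) / n) = 1"
          by (simp add: w_def complex_eq_iff)
        then obtain q :: int where "2 * pi * (real (pos m) - real (pos l)) / n = q * 2 * pi"
          by (auto simp: cos_one_2pi_int)
        then have "2 * pi * ((real (pos m) - real (pos l)) / n) = 2 * pi * q" by simp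
        then have "(real (pos m) - real (pos l)) / n = q" by (subst (asm) mult_left_cancel) simp_all
        then have "real_of_int (int (pos m) - int (pos l)) = real_of_int (q * int n)"
          using n by (simp add: field_simps)
        then have q: "int (pos m) - int (pos l) = q * int n" by (simp only: of_int_eq_iff)
        then have "\<bar>q * int n\<bar> < int n" using \<open>pos m < n\<close> \<open>pos l < n\<close> by linarith
        then have "\<bar>q\<bar> < 1" using n by (simp add: abs_mult)
        then show False using q \<open>pos m \<noteq> pos l\<close> by simp
      qed
      moreover have "w ^ n = cis (2 * pi * (of_int (int (pos m) - int (pos l))))"
        unfolding w_def Complex.DeMoivre by (rule arg_cong [of _ _ cis]) (use n in \<open>simp add: field_simps\<close>)
      then have "w ^ n = 1" by (simp only: cis_multiple_2pi Ints_of_int)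
      ultimately show ?thesis using False by (simp add: geometric_sum)
    qed (simp add: w_def)
    finally show ?thesis by (simp add: w_def)
  qed
  have cis_eq: "cis (- 2 * pi * real (pos k) * real (pos l) / n) * cis (2 * pi * real (pos k) * real (pos m) / n)
      = cis (2 * pi * (real (pos m) - real (pos l)) / n) ^ pos k" for k l :: 'n3
    unfolding cis_mult Complex.DeMoivre by (rule arg_cong [of _ _ cis]) (use n in \<open>simp add: field_simps\<close>)
  have "(\<Sum>k\<in>UNIV. dft_slice X k $ i $ j * cis (2 * pi * real (pos k) * real (pos m) / n))
     = (\<Sum>k\<in>(UNIV :: 'n3 set). \<Sum>l\<in>UNIV. complex_of_real (X $ i $ j $ l) *
          cis (2 * pi * (real (pos m) - real (pos l)) / n) ^ pos k)"
    unfolding dft_slice_def n_def [symmetric] vec_lambda_beta sum_distrib_right mult.assoc [of "complex_of_real _"] cis_eq ..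
  also have "\<dots> = (\<Sum>l\<in>UNIV. complex_of_real (X $ i $ j $ l) * (if l = m then of_nat n else 0))"
    by (subst sum.swap) (simp add: orth flip: sum_distrib_left)
  also have "\<dots> = of_nat n * complex_of_real (X $ i $ j $ m)"
    by (simp add: if_distrib [of "\<lambda>x. _ * x"] cong: if_cong)
  finally show ?thesis by (simp add: n_def)
qed

lemma tnn_add: "tnn (X + Y) \<le> tnn X + tnn Y"
  unfolding tnn_def dft_slice_add distrib_left [symmetric] sum.distrib [symmetric]
  by (intro mult_left_mono sum_mono nuclear_norm_add) simp

lemma tnn_scaleR:
  assumes "0 \<le> c"
  shows "tnn (c *\<^sub>R X) \<le> c * tnn X"
proof -
  have "(\<Sum>k\<in>UNIV. nuclear_norm (dft_slice (c *\<^sub>R X) k)) \<le> (\<Sum>k\<in>UNIV. c * nuclear_norm (dft_slice X k))"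
    unfolding dft_slice_scaleR by (intro sum_mono nuclear_norm_scaleR assms)
  then show ?thesis
    unfolding tnn_def sum_distrib_left [symmetric] mult.left_commute [of c] by (rule mult_left_mono) simp
qed

lemma convex_tnn: "convex_on UNIV tnn"
proof
  fix t :: real and X Y :: "('n1::finite, 'n2::finite, 'n3::{finite, linorder}) tensor"
  assume "0 < t" "t < 1"
  then show "tnn ((1 - t) *\<^sub>R X + t *\<^sub>R Y) \<le> (1 - t) * tnn X + t * tnn Y"
    using tnn_add [of "(1 - t) *\<^sub>R X" "t *\<^sub>R Y"] tnn_scaleR [of "1 - t" X] tnn_scaleR [of t Y] by simp
qed simp

text \<open>An injective linear map on a finite-dimensional space is bounded below, and on each
  Fourier slice the nuclear norm dominates the Frobenius norm.\<close>

lemma tnn_coercive: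
  obtains c :: real where "c > 0"
    "\<And>X :: ('n1::finite, 'n2::finite, 'n3::{finite, linorder}) tensor. c * norm X \<le> tnn X"
proof -
  define F :: "('n1, 'n2, 'n3) tensor \<Rightarrow> (((complex, 'n2) vec, 'n1) vec, 'n3) vec" where "F X = (\<chi> k. dft_slice X k)" for X
  have lin: "linear F"
    by (rule linearI) (simp_all add: F_def vec_eq_iff dft_slice_add dft_slice_scaleR)
  have "X = 0" if "F X = 0" for X
  proof -
    have "dft_slice X k = 0" for k using that by (simp add: F_def vec_eq_iff)
    then have "complex_of_real (X $ i $ j $ m) = 0" for i j m
      using dft_slice_inverse [of X i j m] by simp
    then show ?thesis by (simp add: vec_eq_iff)
  qed
  then have "inj F" using linear_injective_0 [OF lin] by blast
  then obtain b where b: "b > 0" "\<And>X. b * norm X \<le> norm (F X)"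
    using linear_inj_bounded_below_pos [OF lin] by blast
  show thesis
  proof
    show "b / real CARD('n3) > 0" using b by simp
    fix X
    have "b * norm X \<le> norm (F X)" by (rule b)
    also have "\<dots> \<le> (\<Sum>k\<in>UNIV. norm (F X $ k))"
      unfolding norm_vec_def [of "F X"] by (rule L2_set_le_sum) simp
    also have "\<dots> = (\<Sum>k\<in>UNIV. norm (dft_slice X k))" by (simp add: F_def)
    also have "\<dots> \<le> (\<Sum>k\<in>UNIV. nuclear_norm (dft_slice X k))"
      by (intro sum_mono norm_le_nuclear_norm)
    finally show "b / real CARD('n3) * norm X \<le> tnn X"
      by (simp add: tnn_def divide_right_mono)
  qed
qed


section \<open>Convex optimization under linear constraints\<close>

lemma norm_add_scaleR_power2:
  fixes a b :: "'a::real_inner"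
  shows "(norm (a + s *\<^sub>R b))\<^sup>2 = (norm a)\<^sup>2 + 2 * s * (a \<bullet> b) + s\<^sup>2 * (norm b)\<^sup>2"
  unfolding power2_norm_eq_inner
  by (simp add: inner_add_left inner_add_right inner_commute [of b a] power2_eq_square algebra_simps)

lemma least_squares_normal_equation:
  assumes J: "linear J" and min: "\<And>y. norm (u - J d) \<le> norm (u - J y)"
  shows "(u - J d) \<bullet> J e = 0"
proof -
  interpret J: linear J by fact
  have *: "0 \<le> - 2 * ((u - J d) \<bullet> J e)" for e
  proof (rule quadratic_nonneg_imp_linear_nonneg)
    fix s :: real
    have eq: "u - J (d + s *\<^sub>R e) = (u - J d) + (- s) *\<^sub>R J e" by (simp add: J.add J.scaleR)
    have "(norm (u - J d))\<^sup>2 \<le> (norm (u - J (d + s *\<^sub>R e)))\<^sup>2"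
      using min by (intro power_mono) auto
    then show "0 \<le> s * (- 2 * ((u - J d) \<bullet> J e)) + s\<^sup>2 * (norm (J e))\<^sup>2"
      unfolding eq norm_add_scaleR_power2 by simp
  qed
  show ?thesis using * [of e] * [of "- e"] by (simp add: J.neg)
qed

text \<open>First-order condition without subgradients: along the segment from \<open>x\<close> to
  \<open>y\<close>, convexity bounds \<open>f\<close>, the squares are expanded exactly, and the
  terms linear in the step length are compared.\<close>

lemma convex_plus_least_squares_optimality:
  fixes f :: "'x::real_vector \<Rightarrow> real"
    and G1 :: "'x \<Rightarrow> 'u::real_inner" and G2 :: "'x \<Rightarrow> 'v::real_inner"
  assumes f: "convex_on UNIV f" and G: "linear G1" "linear G2"
    and min: "\<And>y. f x + \<mu>1 / 2 * (norm (G1 x + b1))\<^sup>2 + \<mu>2 / 2 * (norm (G2 x + b2))\<^sup>2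
      \<le> f y + \<mu>1 / 2 * (norm (G1 y + b1))\<^sup>2 + \<mu>2 / 2 * (norm (G2 y + b2))\<^sup>2"
  shows "0 \<le> f y - f x + \<mu>1 * ((G1 x + b1) \<bullet> G1 (y - x)) + \<mu>2 * ((G2 x + b2) \<bullet> G2 (y - x))"
proof (rule quadratic_nonneg_imp_linear_nonneg)
  fix s :: real assume s: "0 < s" "s \<le> 1"
  define z where "z = x + s *\<^sub>R (y - x)"
  have expand: "(norm (G z + b))\<^sup>2 = (norm (G x + b))\<^sup>2 + 2 * s * ((G x + b) \<bullet> G (y - x)) + s\<^sup>2 * (norm (G (y - x)))\<^sup>2"
    if "linear G" for G :: "'x \<Rightarrow> 'w::real_inner" and b
  proof -
    have eq: "G z + b = (G x + b) + s *\<^sub>R G (y - x)"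
      using that by (simp add: z_def linear_add linear_scale)
    show ?thesis unfolding eq norm_add_scaleR_power2 ..
  qed
  have "z = (1 - s) *\<^sub>R x + s *\<^sub>R y" by (simp add: z_def algebra_simps)
  then have "f z \<le> (1 - s) * f x + s * f y" using convex_onD [OF f, of s x y] s by simp
  then have "0 \<le> s * (f y - f x) + \<mu>1 / 2 * (norm (G1 z + b1))\<^sup>2 + \<mu>2 / 2 * (norm (G2 z + b2))\<^sup>2
      - \<mu>1 / 2 * (norm (G1 x + b1))\<^sup>2 - \<mu>2 / 2 * (norm (G2 x + b2))\<^sup>2"
    using min [of z] by (simp add: algebra_simps)
  also have "\<dots> = s * (f y - f x + \<mu>1 * ((G1 x + b1) \<bullet> G1 (y - x)) + \<mu>2 * ((G2 x + b2) \<bullet> G2 (y - x)))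
      + s\<^sup>2 * (\<mu>1 / 2 * (norm (G1 (y - x)))\<^sup>2 + \<mu>2 / 2 * (norm (G2 (y - x)))\<^sup>2)"
    unfolding expand [OF G(1)] expand [OF G(2)] by (simp add: algebra_simps)
  finally show "0 \<le> s * (f y - f x + \<mu>1 * ((G1 x + b1) \<bullet> G1 (y - x)) + \<mu>2 * ((G2 x + b2) \<bullet> G2 (y - x)))
      + s\<^sup>2 * (\<mu>1 / 2 * (norm (G1 (y - x)))\<^sup>2 + \<mu>2 / 2 * (norm (G2 (y - x)))\<^sup>2)" .
qed

lemma orthogonal_projection_exists:
  fixes S :: "'a::euclidean_space set"
  assumes "subspace S"
  obtains P where "linear P" "\<And>u. P u \<in> S" "\<And>u s. s \<in> S \<Longrightarrow> s \<bullet> (u - P u) = 0"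
proof -
  obtain B where B: "B \<subseteq> S" "pairwise orthogonal B" "\<And>b. b \<in> B \<Longrightarrow> norm b = 1"
    "independent B" "span B = S"
    using orthonormal_basis_subspace [OF assms] by metis
  have fin: "finite B" using B(4) by (rule independent_imp_finite)
  define P where "P u = (\<Sum>b\<in>B. (u \<bullet> b) *\<^sub>R b)" for u
  show thesis
  proof
    show "linear P"
      by (rule linearI) (simp_all add: P_def inner_add_left scaleR_add_left sum.distrib scaleR_sum_right)
    show "P u \<in> S" for u
      unfolding P_def using B(1) assms by (intro subspace_sum subspace_scale) auto
    fix u s assume "s \<in> S"
    have "b \<bullet> P u = u \<bullet> b" if "b \<in> B" for b
    proof -
      have "b \<bullet> P u = (\<Sum>c\<in>B. if c = b then u \<bullet> c else 0)"
        unfolding P_def inner_sum_right using B(2,3) that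
        by (intro sum.cong refl) (auto simp: pairwise_def orthogonal_def norm_eq_1)
      then show ?thesis using fin that by simp
    qed
    then have "b \<bullet> (u - P u) = 0" if "b \<in> B" for b
      using that by (simp add: inner_diff_right inner_commute)
    then have "B \<subseteq> {s. s \<bullet> (u - P u) = 0}" by auto
    moreover have "subspace {s. s \<bullet> (u - P u) = 0}"
      by (auto simp: subspace_def inner_add_left)
    ultimately have "span B \<subseteq> {s. s \<bullet> (u - P u) = 0}" by (rule span_minimal)
    then show "s \<bullet> (u - P u) = 0" using \<open>s \<in> S\<close> B(5) by blast
  qed
qed

text \<open>The difference of two candidates lies in \<open>S\<close> and is orthogonal to
  \<open>S\<close>, hence to itself.\<close>

lemma orthogonal_projection_eqI:
  assumes S: "subspace S" and P: "\<And>u. P u \<in> S" "\<And>u s. s \<in> S \<Longrightarrow> s \<bullet> (u - P u) = 0"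
    and p: "p \<in> S" "\<And>s. s \<in> S \<Longrightarrow> s \<bullet> (u - p) = 0"
  shows "P u = p"
proof -
  have "P u - p \<in> S" using S P(1) p(1) by (rule subspace_diff)
  then have "(P u - p) \<bullet> (u - p) - (P u - p) \<bullet> (u - P u) = 0" using P(2) p(2) by simp
  then have "(P u - p) \<bullet> (P u - p) = 0" by (simp add: inner_diff_right)
  then show ?thesis by simp
qed

lemma orthogonal_projection_selfadjoint:
  assumes P: "\<And>u. P u \<in> S" "\<And>u s. s \<in> S \<Longrightarrow> s \<bullet> (u - P u) = 0"
  shows "P u \<bullet> v = u \<bullet> P v"
  using P(2) [OF P(1) [of u], of v] P(2) [OF P(1) [of v], of u]
  by (simp add: inner_diff_right inner_commute)

text \<open>Lagrange multipliers by separation: the origin is separated from the convex set of pairs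
  of a change of the constraint value and a number above the increase of \<open>f\<close>. The
  multiplier is the normal, scaled so that its last coordinate is 1.\<close>

lemma linear_constraint_multiplier:
  fixes f :: "'x::euclidean_space \<Rightarrow> real" and C :: "'x \<Rightarrow> 'u::euclidean_space"
  assumes f: "convex_on UNIV f" and C: "linear C"
    and min: "\<And>x. C x = C x0 \<Longrightarrow> f x0 \<le> f x"
  obtains z where "\<And>x. f x0 \<le> f x + z \<bullet> C (x - x0)"
proof -
  interpret C: linear C by fact
  define S where "S = {(C (x - x0), r) | x r. f x - f x0 < r}"
  have "convex S"
  proof (rule convexI)
    fix p q and u v :: real
    assume p: "p \<in> S" and q: "q \<in> S" and uv: "0 \<le> u" "0 \<le> v" "u + v = 1"
    from p obtain x r where x: "p = (C (x - x0), r)" "f x - f x0 < r" by (auto simp: S_def)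
    from q obtain y s where y: "q = (C (y - x0), s)" "f y - f x0 < s" by (auto simp: S_def)
    have u: "u = 1 - v" using uv by simp
    have "f (u *\<^sub>R x + v *\<^sub>R y) \<le> u * f x + v * f y"
      unfolding u using uv by (intro convex_onD [OF f]) auto
    moreover have "u * (f x - f x0) + v * (f y - f x0) < u * r + v * s"
    \<comment> \<open>The strict inequality is inherited from a summand with positive
      weight.\<close>
    proof (cases "u = 0")
      case False
      then have "u * (f x - f x0) < u * r" using x uv by (intro mult_strict_left_mono) auto
      moreover have "v * (f y - f x0) \<le> v * s" using y uv by (intro mult_left_mono) auto
      ultimately show ?thesis by linarith
    qed (use uv y in simp)
    moreover have "u * (f x - f x0) + v * (f y - f x0) = u * f x + v * f y - f x0"
      unfolding u by (simp add: algebra_simps)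
    ultimately have "f (u *\<^sub>R x + v *\<^sub>R y) - f x0 < u * r + v * s" by linarith
    moreover have "u *\<^sub>R (x - x0) + v *\<^sub>R (y - x0) = u *\<^sub>R x + v *\<^sub>R y - x0"
      unfolding u by (simp add: algebra_simps)
    then have "u *\<^sub>R C (x - x0) + v *\<^sub>R C (y - x0) = C (u *\<^sub>R x + v *\<^sub>R y - x0)"
      by (simp only: C.add [symmetric] C.scaleR [symmetric])
    ultimately show "u *\<^sub>R p + v *\<^sub>R q \<in> S" unfolding S_def x y by auto
  qed
  moreover have "(C (x0 - x0), 1) \<in> S" unfolding S_def mem_Collect_eq by (intro exI [of _ x0] exI [of _ 1] conjI) auto
  then have "S \<noteq> {}" by blast
  moreover have "0 \<notin> S"
  proof
    assume "0 \<in> S"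
    then obtain x where "C (x - x0) = 0" "f x - f x0 < 0" by (auto simp: S_def zero_prod_def)
    then show False using min [of x] by (simp add: C.diff)
  qed
  \<comment> \<open>A normal in the span of \<open>S\<close> has its first component
    \<open>z\<close> in the range of \<open>C\<close>. If the last component were 0, testing with a
    preimage of \<open>- z\<close> would force \<open>z = 0\<close>, so the hyperplane is not
    vertical.\<close>
  ultimately obtain a where a: "a \<in> span S" "a \<noteq> 0" "\<And>p. p \<in> S \<Longrightarrow> 0 \<le> a \<bullet> p"
    using separating_hyperplane_set_0_inspan by blast
  obtain z s where zs: "a = (z, s)" by (cases a)
  have sep: "0 \<le> z \<bullet> C (x - x0) + s * r" if "f x - f x0 < r" for x r
    using a(3) [of "(C (x - x0), r)"] that by (auto simp: S_def zs)
  have "S \<subseteq> range C \<times> UNIV" by (auto simp: S_def)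
  moreover have "subspace (range C \<times> (UNIV :: real set))"
    by (intro subspace_Times subspace_UNIV linear_subspace_image C)
  ultimately have "z \<in> range C" using a(1) span_minimal zs by blast
  then obtain d where d: "z = C d" by auto
  have "s \<ge> 0" using sep [of x0 1] by (simp add: C.zero)
  moreover have "s \<noteq> 0"
  proof
    assume "s = 0"
    then have "0 \<le> z \<bullet> C (x0 - d - x0)" using sep [of "x0 - d" "f (x0 - d) - f x0 + 1"] by simp
    then have "z \<bullet> z \<le> 0" using d by (simp add: C.neg)
    then have "z = 0" using inner_ge_zero [of z] by simp
    then show False using a(2) zs \<open>s = 0\<close> by (simp add: zero_prod_def)
  qed
  ultimately have s: "s > 0" by simp
  show thesis
  proof
    fix x
    have "0 \<le> z \<bullet> C (x - x0) + s * (f x - f x0)"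
    \<comment> \<open>\<open>S\<close> requires a strict inequality; the slack \<open>e / s\<close>
      is made arbitrarily small.\<close>
    proof (rule field_le_epsilon)
      fix e :: real assume "e > 0"
      then show "0 \<le> z \<bullet> C (x - x0) + s * (f x - f x0) + e"
        using sep [of x "f x - f x0 + e / s"] s by (simp add: distrib_left)
    qed
    then have "0 \<le> (z \<bullet> C (x - x0) + s * (f x - f x0)) / s" using s by simp
    also have "\<dots> = (z /\<^sub>R s) \<bullet> C (x - x0) + (f x - f x0)"
      using s by (simp add: field_simps)
    finally show "f x0 \<le> f x + (z /\<^sub>R s) \<bullet> C (x - x0)" by simp
  qed
qed

text \<open>By coercivity, competitors no worse than \<open>x1\<close> lie in a ball, whose
  intersection with the closed affine set is compact; convexity makes \<open>f\<close>
  continuous.\<close>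

lemma coercive_attains_inf_on_affine:
  fixes f :: "'x::euclidean_space \<Rightarrow> real"
  assumes f: "convex_on UNIV f" and c: "0 < c" "\<And>x. c * norm x \<le> f x"
    and C: "linear C" and x1: "C x1 = (b :: 'u::euclidean_space)"
  obtains x0 where "C x0 = b" "\<And>x. C x = b \<Longrightarrow> f x0 \<le> f x"
proof -
  have cont: "continuous_on A f" for A
    using convex_on_continuous [OF open_UNIV f] continuous_on_subset by blast
  define A where "A = {x. C x = b} \<inter> cball 0 (f x1 / c)"
  have "closed {x. C x = b}"
    using C by (intro closed_Collect_eq continuous_intros linear_continuous_on)
      (simp add: linear_conv_bounded_linear)
  then have "compact A" unfolding A_def by (intro closed_Int_compact) auto
  have le: "norm x \<le> f x / c" for x using c by (simp add: pos_le_divide_eq mult.commute)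
  have "x1 \<in> A" using le x1 by (simp add: A_def)
  then obtain x0 where x0: "x0 \<in> A" and min: "\<And>x. x \<in> A \<Longrightarrow> f x0 \<le> f x"
    using continuous_attains_inf [OF \<open>compact A\<close> _ cont] by blast
  show thesis
  proof
    show "C x0 = b" using x0 by (simp add: A_def)
    fix x assume x: "C x = b"
    show "f x0 \<le> f x"
    proof (cases "f x \<le> f x1")
      case True
      then have "norm x \<le> f x1 / c"
        using le [of x] divide_right_mono [of "f x" "f x1" c] c by simp
      then show ?thesis using min x by (simp add: A_def)
    next
      case False
      then show ?thesis using min [OF \<open>x1 \<in> A\<close>] by simp
    qed
  qed
qed

text \<open>Infinitely many terms at distance at least \<open>e\<close> from \<open>a\<close> would
  have a cluster point of their own, which could not be \<open>a\<close>.\<close>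

lemma bounded_unique_cluster_point_tendsto:
  fixes x :: "nat \<Rightarrow> 'a::heine_borel"
  assumes "bounded (range x)"
    and "\<And>s l. strict_mono (s :: nat \<Rightarrow> nat) \<Longrightarrow> (x \<circ> s) \<longlonglongrightarrow> l \<Longrightarrow> l = a"
  shows "x \<longlonglongrightarrow> a"
proof (rule ccontr)
  assume "\<not> x \<longlonglongrightarrow> a"
  then obtain e where e: "e > 0" "\<exists>\<^sub>F n in sequentially. \<not> dist (x n) a < e"
    by (auto simp: tendsto_iff not_eventually)
  then have "infinite {n. \<not> dist (x n) a < e}" by (simp add: frequently_sequentially infinite_nat_iff_unbounded_le)
  then obtain s :: "nat \<Rightarrow> nat" where s: "strict_mono s" "\<And>n. \<not> dist (x (s n)) a < e"
    using infinite_enumerate by blast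
  have "bounded (range (x \<circ> s))" using assms(1) by (rule bounded_subset) auto
  then obtain l r where r: "strict_mono r" "((x \<circ> s) \<circ> r) \<longlonglongrightarrow> l"
    using bounded_imp_convergent_subsequence by blast
  then have "l = a" using assms(2) [of "s \<circ> r" l] s by (simp add: o_assoc strict_mono_o)
  then have "\<forall>\<^sub>F n in sequentially. dist (((x \<circ> s) \<circ> r) n) a < e" using r e(1) tendstoD by blast
  then show False using s(2) by (auto simp: eventually_sequentially)
qed

lemma tendsto_inner_bounded_zero:
  assumes "bounded (range a)" and "b \<longlonglongrightarrow> 0"
  shows "(\<lambda>n. a n \<bullet> b n) \<longlonglongrightarrow> 0"
  using bounded_bilinear.Bfun_prod_Zfun [OF bounded_bilinear_inner, of a sequentially b] assms
  by (simp add: tendsto_Zfun_iff Bseq_eq_bounded)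


section \<open>A proximal method of multipliers\<close>

text \<open>Turns the product of a step with the new error into a telescoping difference of
  squares.\<close>

lemma power2_norm_diff_step:
  fixes a b :: "'a::real_inner"
  shows "(norm b)\<^sup>2 = (norm a)\<^sup>2 + 2 * ((b - a) \<bullet> b) - (norm (b - a))\<^sup>2"
  unfolding power2_norm_eq_inner by (simp add: inner_diff_left inner_diff_right inner_commute)

text \<open>Expand the square of \<open>\<mu> *\<^sub>R a - 2 *\<^sub>R b\<close>. The factor
  \<open>\<mu> / 2\<close> is chosen so that half of a term \<open>\<mu> * (norm a)\<^sup>2\<close>
  survives in the descent estimate.\<close>

lemma inner_Young:
  fixes a b :: "'a::real_inner"
  assumes "0 < \<mu>"
  shows "2 * (a \<bullet> b) \<le> \<mu> / 2 * (norm a)\<^sup>2 + 2 / \<mu> * (norm b)\<^sup>2"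
proof -
  have "0 \<le> (norm (\<mu> *\<^sub>R a + (- 2) *\<^sub>R b))\<^sup>2 / (2 * \<mu>)" using assms by simp
  also have "\<dots> = \<mu> / 2 * (norm a)\<^sup>2 - 2 * (a \<bullet> b) + 2 / \<mu> * (norm b)\<^sup>2"
    unfolding norm_add_scaleR_power2 using assms by (simp add: field_simps power2_eq_square)
  finally show ?thesis by simp
qed

lemma linear_tendsto:
  fixes G :: "'a::euclidean_space \<Rightarrow> 'b::real_normed_vector"
  shows "linear G \<Longrightarrow> (g \<longlongrightarrow> a) F \<Longrightarrow> ((\<lambda>n. G (g n)) \<longlongrightarrow> G a) F"
  by (simp add: bounded_linear.tendsto linear_conv_bounded_linear)

lemma tendsto_zero_of_power2_norm_le:
  assumes "\<And>t. c * (norm (d t))\<^sup>2 \<le> \<phi> t - \<phi> (Suc t)" and "0 < c" and "convergent \<phi>"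
  shows "d \<longlonglongrightarrow> 0"
proof -
  obtain l where "\<phi> \<longlonglongrightarrow> l" using assms(3) by (auto simp: convergent_def)
  then have "(\<lambda>t. \<phi> t - \<phi> (Suc t)) \<longlonglongrightarrow> l - l" by (intro tendsto_diff LIMSEQ_Suc)
  then have "(\<lambda>t. (\<phi> t - \<phi> (Suc t)) / c) \<longlonglongrightarrow> (l - l) / c" by (intro tendsto_divide) (use assms(2) in auto)
  then have lim: "(\<lambda>t. (\<phi> t - \<phi> (Suc t)) / c) \<longlonglongrightarrow> 0" by simp
  have "(\<lambda>t. (norm (d t))\<^sup>2) \<longlonglongrightarrow> 0"
    by (rule tendsto_sandwich [OF _ _ tendsto_const lim])
      (use assms(1,2) in \<open>auto simp: field_simps\<close>)
  then have "(\<lambda>t. norm (d t)) \<longlonglongrightarrow> 0" by simp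
  then show ?thesis by (rule tendsto_norm_zero_cancel)
qed

text \<open>The blocks occur only through their images: \<open>j\<close> and \<open>jh\<close> stand
  for the Jacobian operator applied to the full and half steps, \<open>w\<close> for the combination
  of \<open>A\<close> and \<open>B\<close> in the spectral constraint, and \<open>b\<close> for the
  warped image. These images are determined even where the minimizing blocks are not.\<close>

locale proximal_multiplier_method =
  fixes f :: "'x::euclidean_space \<Rightarrow> real"
    and K :: "'x \<Rightarrow> 'u::euclidean_space" and W :: "'x \<Rightarrow> 'v::euclidean_space"
    and Pr :: "'u \<Rightarrow> 'u" and b :: 'u and c \<mu>1 \<mu>2 \<rho> :: real
    and x :: "nat \<Rightarrow> 'x" and j jh o1 :: "nat \<Rightarrow> 'u" and w o2 :: "nat \<Rightarrow> 'v"
  assumes convex: "convex_on UNIV f" and c: "0 < c" and coercive: "\<And>y. c * norm y \<le> f y"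
    and K: "linear K" and W: "linear W" and Pr: "linear Pr"
    and idem: "\<And>u. Pr (Pr u) = Pr u" and selfadjoint: "\<And>u v. Pr u \<bullet> v = u \<bullet> Pr v"
    and \<mu>1: "0 < \<mu>1" and \<mu>2: "0 < \<mu>2" and \<rho>: "0 < \<rho>" "\<rho> < 2"
    and jh: "\<And>t. jh t = Pr (K (x t) - b + o1 t /\<^sub>R \<mu>1)"
    and x_min: "\<And>t y. f (x (Suc t)) + \<mu>1 / 2 * (norm (K (x (Suc t)) + (o1 t /\<^sub>R \<mu>1 - b - jh t)))\<^sup>2
         + \<mu>2 / 2 * (norm (W (x (Suc t)) + (o2 t /\<^sub>R \<mu>2 - w t)))\<^sup>2
       \<le> f y + \<mu>1 / 2 * (norm (K y + (o1 t /\<^sub>R \<mu>1 - b - jh t)))\<^sup>2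
         + \<mu>2 / 2 * (norm (W y + (o2 t /\<^sub>R \<mu>2 - w t)))\<^sup>2"
    and j: "\<And>t. j (Suc t) = Pr (K (x (Suc t)) - b + o1 t /\<^sub>R \<mu>1)"
    and w: "\<And>t. w (Suc t) = W (x (Suc t)) + o2 t /\<^sub>R \<mu>2"
    and o1: "\<And>t. o1 (Suc t) = o1 t + (\<rho> * \<mu>1) *\<^sub>R (K (x (Suc t)) - b - j (Suc t))"
    and o2: "\<And>t. o2 (Suc t) = o2 t + (\<rho> * \<mu>2) *\<^sub>R (W (x (Suc t)) - w (Suc t))"
begin

interpretation K: linear K by (rule K)
interpretation W: linear W by (rule W)
interpretation Pr: linear Pr by (rule Pr)

definition Q :: "'u \<Rightarrow> 'u" where "Q u = u - Pr u"

sublocale Q: linear Q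
  by (rule linearI) (simp_all add: Q_def Pr.add Pr.scaleR algebra_simps)

lemma Pr_Q [simp]: "Pr (Q u) = 0" and Q_Pr [simp]: "Q (Pr u) = 0"
  and Q_idem [simp]: "Q (Q u) = Q u" and Pr_plus_Q: "Pr u + Q u = u"
  by (simp_all add: Q_def Pr.diff idem Pr.zero)

lemma Q_selfadjoint: "Q u \<bullet> v = u \<bullet> Q v"
  by (simp add: Q_def inner_diff_left inner_diff_right selfadjoint)

text \<open>The part of \<open>o1\<close> that acts as multiplier of the reduced constraint; the
  other part, \<open>Pr (o1 t)\<close>, dies out geometrically.\<close>

definition z :: "nat \<Rightarrow> 'u" where "z t = Q (o1 t)"

definition r :: "nat \<Rightarrow> 'u" where "r t = Q (K (x t) - b)"

text \<open>Saddle points of the problem reduced to the constraint \<open>Q (K y - b) = 0\<close>: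
  \<open>xs\<close> is feasible and minimizes the Lagrangian with multiplier \<open>zs\<close>. The
  spectral constraint can always be met by the free block \<open>B\<close>, so its multiplier is
  0.\<close>

definition KKT :: "'x \<Rightarrow> 'u \<Rightarrow> bool" where
  "KKT xs zs \<longleftrightarrow> Q (K xs - b) = 0 \<and> (\<forall>y. f xs \<le> f y + zs \<bullet> Q (K (y - xs)))"

text \<open>The exact fit \<open>j (Suc t)\<close> removes the projected observation and leaves
  \<open>- Pr (o1 t)\<close>, scaled, in its place. This decouples the multiplier update into an
  update of \<open>z\<close> by \<open>r\<close> and a multiplication of \<open>Pr (o1 t)\<close> by
  \<open>1 - \<rho>\<close>.\<close>

lemma residual: "K (x (Suc t)) - b - j (Suc t) = r (Suc t) - Pr (o1 t) /\<^sub>R \<mu>1"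
  unfolding j r_def Q_def Pr.add Pr.scaleR by simp

lemma z_Suc: "z (Suc t) = z t + (\<rho> * \<mu>1) *\<^sub>R r (Suc t)"
  unfolding z_def o1 residual Q.add Q.scaleR Q.diff by (simp add: r_def)

lemma Pr_o1_Suc: "Pr (o1 (Suc t)) = (1 - \<rho>) *\<^sub>R Pr (o1 t)"
  unfolding o1 residual Pr.add Pr.scaleR Pr.diff idem using \<mu>1 by (simp add: r_def algebra_simps)

lemma o2_Suc: "o2 (Suc t) = (1 - \<rho>) *\<^sub>R o2 t"
  unfolding o2 w using \<mu>2 by (simp add: algebra_simps)

lemma geometric_decay:
  assumes "\<And>t. g (Suc t) = (1 - \<rho>) *\<^sub>R (g t :: 'w::real_normed_vector)"
  shows "g \<longlonglongrightarrow> 0"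
proof -
  have "g t = ((1 - \<rho>) ^ t) *\<^sub>R g 0" for t by (induction t) (simp_all add: assms)
  then have "g = (\<lambda>t. ((1 - \<rho>) ^ t) *\<^sub>R g 0)" by blast
  moreover have "(\<lambda>t. ((1 - \<rho>) ^ t) *\<^sub>R g 0) \<longlonglongrightarrow> 0 *\<^sub>R g 0"
    using \<rho> by (intro tendsto_scaleR LIMSEQ_power_zero tendsto_const) auto
  ultimately show ?thesis by simp
qed

lemma Pr_o1_tendsto: "(\<lambda>t. Pr (o1 t)) \<longlonglongrightarrow> 0"
  by (rule geometric_decay) (rule Pr_o1_Suc)

lemma o2_tendsto: "o2 \<longlonglongrightarrow> 0"
  by (rule geometric_decay) (rule o2_Suc)

text \<open>The gradient of the spatial penalty is split along \<open>Q\<close> and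
  \<open>Pr\<close>. As the half step has already fitted the \<open>Pr\<close> part at
  \<open>x t\<close>, only the increment of \<open>x\<close> remains there; this is the proximal
  term that the symmetric sweep provides.\<close>

lemma optimality:
  "0 \<le> f y - f (x (Suc t)) + (z t + \<mu>1 *\<^sub>R r (Suc t)) \<bullet> Q (K (y - x (Suc t)))
     + \<mu>1 * (Pr (K (x (Suc t) - x t)) \<bullet> Pr (K (y - x (Suc t))))
     + \<mu>2 * ((w (Suc t) - w t) \<bullet> W (y - x (Suc t)))"
proof -
  have "0 \<le> f y - f (x (Suc t))
      + \<mu>1 * ((K (x (Suc t)) + (o1 t /\<^sub>R \<mu>1 - b - jh t)) \<bullet> K (y - x (Suc t)))
      + \<mu>2 * ((W (x (Suc t)) + (o2 t /\<^sub>R \<mu>2 - w t)) \<bullet> W (y - x (Suc t)))"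
    by (rule convex_plus_least_squares_optimality [OF convex K W x_min])
  moreover have "W (x (Suc t)) + (o2 t /\<^sub>R \<mu>2 - w t) = w (Suc t) - w t" by (simp add: w)
  moreover have "K (x (Suc t)) + (o1 t /\<^sub>R \<mu>1 - b - jh t)
      = Q (r (Suc t) + z t /\<^sub>R \<mu>1) + Pr (Pr (K (x (Suc t) - x t)))"
    unfolding jh idem z_def r_def Q.add Q.scaleR Q_idem
    by (simp add: Q_def Pr.diff Pr.add Pr.scaleR K.diff algebra_simps)
  then have "(K (x (Suc t)) + (o1 t /\<^sub>R \<mu>1 - b - jh t)) \<bullet> K (y - x (Suc t))
      = (r (Suc t) + z t /\<^sub>R \<mu>1) \<bullet> Q (K (y - x (Suc t)))
        + Pr (K (x (Suc t) - x t)) \<bullet> Pr (K (y - x (Suc t)))"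
    by (simp only: inner_add_left Q_selfadjoint selfadjoint)
  moreover have "\<mu>1 * ((r (Suc t) + z t /\<^sub>R \<mu>1) \<bullet> v) = (z t + \<mu>1 *\<^sub>R r (Suc t)) \<bullet> v" for v
    using \<mu>1 by (simp add: inner_add_left distrib_left)
  ultimately show ?thesis by (simp add: distrib_left)
qed

text \<open>Coercivity gives a minimizer of the reduced problem, and separation gives its
  multiplier.\<close>

lemma KKT_exists:
  assumes "Q (K x1 - b) = 0"
  shows "\<exists>xs zs. KKT xs zs"
proof -
  have lin: "linear (\<lambda>y. Q (K y))"
    by (rule linearI) (simp_all add: K.add K.scaleR Q.add Q.scaleR)
  have eq: "Q (K y) = Q b \<longleftrightarrow> Q (K y - b) = 0" for y by (simp add: Q.diff)
  obtain xs where xs: "Q (K xs) = Q b" and min: "\<And>y. Q (K y) = Q b \<Longrightarrow> f xs \<le> f y"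
    using coercive_attains_inf_on_affine [OF convex c coercive lin, of x1 "Q b"] assms by (metis eq)
  obtain zs where "\<And>y. f xs \<le> f y + zs \<bullet> Q (K (y - xs))"
    using linear_constraint_multiplier [OF convex lin, of xs] min by (metis xs)
  then show ?thesis using xs eq unfolding KKT_def by blast
qed

text \<open>
  The weight of the last term is chosen so that its geometric decay absorbs the error
  \<open>2 / \<mu>2 * (norm (o2 t))\<^sup>2\<close> from Young's inequality.
\<close>

definition Lyapunov :: "'x \<Rightarrow> 'u \<Rightarrow> nat \<Rightarrow> real" where
  "Lyapunov xs zs t = (norm (z t - zs))\<^sup>2 / (\<rho> * \<mu>1) + \<mu>1 * (norm (Pr (K (x t - xs))))\<^sup>2
     + \<mu>2 * (norm (w t - W xs))\<^sup>2 + 2 / (\<mu>2 * (1 - (1 - \<rho>)\<^sup>2)) * (norm (o2 t))\<^sup>2"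

lemma weight_pos: "0 < 1 - (1 - \<rho>)\<^sup>2"
  using \<rho> by (simp add: power2_eq_square algebra_simps)

text \<open>Test \<open>optimality\<close> at \<open>xs\<close> and the KKT inequality at
  \<open>x (Suc t)\<close>; in the sum the values of \<open>f\<close> cancel. The remaining products
  telescope. The update of \<open>z\<close> returns \<open>\<rho> * \<mu>1\<close> of the available
  \<open>2 * \<mu>1\<close> times the squared residual, which leaves the factor
  \<open>2 - \<rho>\<close>.\<close>

lemma Lyapunov_descent:
  assumes "KKT xs zs"
  shows "(2 - \<rho>) * \<mu>1 * (norm (r (Suc t)))\<^sup>2 + \<mu>1 * (norm (Pr (K (x (Suc t) - x t))))\<^sup>2
      + \<mu>2 / 2 * (norm (w (Suc t) - w t))\<^sup>2 \<le> Lyapunov xs zs t - Lyapunov xs zs (Suc t)"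
proof -
  define r' a a' d d' where "r' = r (Suc t)" and "a = Pr (K (x t - xs))" and "a' = Pr (K (x (Suc t) - xs))"
    and "d = w t - W xs" and "d' = w (Suc t) - W xs"
  have "Q (K (xs - x (Suc t))) = Q (K xs - b) - r'"
    by (simp add: r'_def r_def K.diff Q.diff)
  then have Qr: "Q (K (xs - x (Suc t))) = - r'" using assms by (simp add: KKT_def)
  then have Qr': "Q (K (x (Suc t) - xs)) = r'" by (metis K.neg Q.neg minus_diff_eq minus_minus)
  have aa: "Pr (K (x (Suc t) - x t)) = a' - a" "Pr (K (xs - x (Suc t))) = - a'"
    by (simp_all add: a_def a'_def K.diff Pr.diff)
  \<comment> \<open>\<open>w (Suc t)\<close> overshoots \<open>W (x (Suc t))\<close> by a multiple
    of \<open>o2 t\<close>; this mismatch is the source of the error that Young's inequality has to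
    absorb.\<close>
  have dd: "w (Suc t) - w t = d' - d" "W (xs - x (Suc t)) = o2 t /\<^sub>R \<mu>2 - d'"
    by (simp_all add: d_def d'_def w W.diff)
  have "f xs \<le> f (x (Suc t)) + zs \<bullet> r'" using assms Qr' unfolding KKT_def by metis
  moreover have "0 \<le> f xs - f (x (Suc t)) + (z t + \<mu>1 *\<^sub>R r') \<bullet> (- r') + \<mu>1 * ((a' - a) \<bullet> (- a'))
      + \<mu>2 * ((d' - d) \<bullet> (o2 t /\<^sub>R \<mu>2 - d'))"
    using optimality [of xs t] unfolding Qr aa dd r'_def [symmetric] .
  moreover have "\<mu>2 * ((d' - d) \<bullet> (o2 t /\<^sub>R \<mu>2 - d')) = (d' - d) \<bullet> o2 t - \<mu>2 * ((d' - d) \<bullet> d')"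
    using \<mu>2 by (simp add: inner_diff_right right_diff_distrib mult.assoc [symmetric])
  moreover have "(z t + \<mu>1 *\<^sub>R r') \<bullet> (- r') = - (z t \<bullet> r') - \<mu>1 * (norm r')\<^sup>2"
    by (simp add: inner_add_left power2_norm_eq_inner)
  moreover have "\<mu>1 * ((a' - a) \<bullet> (- a')) = - (\<mu>1 * ((a' - a) \<bullet> a'))"
    by (simp only: inner_minus_right mult_minus_right)
  moreover have "(z t - zs) \<bullet> r' = z t \<bullet> r' - zs \<bullet> r'" by (rule inner_diff_left)
  ultimately have main: "0 \<le> - ((z t - zs) \<bullet> r') - \<mu>1 * (norm r')\<^sup>2 - \<mu>1 * ((a' - a) \<bullet> a')
      + (d' - d) \<bullet> o2 t - \<mu>2 * ((d' - d) \<bullet> d')"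
    by linarith
  have "z (Suc t) - zs = (z t - zs) + (\<rho> * \<mu>1) *\<^sub>R r'" by (simp add: z_Suc r'_def)
  then have "(norm (z (Suc t) - zs))\<^sup>2
      = (norm (z t - zs))\<^sup>2 + 2 * (\<rho> * \<mu>1) * ((z t - zs) \<bullet> r') + (\<rho> * \<mu>1)\<^sup>2 * (norm r')\<^sup>2"
    by (simp only: norm_add_scaleR_power2)
  then have z_step: "(norm (z (Suc t) - zs))\<^sup>2 / (\<rho> * \<mu>1)
      = (norm (z t - zs))\<^sup>2 / (\<rho> * \<mu>1) + 2 * ((z t - zs) \<bullet> r') + \<rho> * \<mu>1 * (norm r')\<^sup>2"
    using \<rho>(1) \<mu>1 by (simp add: add_divide_distrib power2_eq_square)
  have a_step: "\<mu>1 * (norm a')\<^sup>2 = \<mu>1 * (norm a)\<^sup>2 + 2 * (\<mu>1 * ((a' - a) \<bullet> a')) - \<mu>1 * (norm (a' - a))\<^sup>2"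
    unfolding power2_norm_diff_step [of a' a] by (simp add: algebra_simps)
  have d_step: "\<mu>2 * (norm d')\<^sup>2 = \<mu>2 * (norm d)\<^sup>2 + 2 * (\<mu>2 * ((d' - d) \<bullet> d')) - \<mu>2 * (norm (d' - d))\<^sup>2"
    unfolding power2_norm_diff_step [of d' d] by (simp add: algebra_simps)
  have o_step: "2 / (\<mu>2 * (1 - (1 - \<rho>)\<^sup>2)) * (norm (o2 (Suc t)))\<^sup>2
      = 2 / (\<mu>2 * (1 - (1 - \<rho>)\<^sup>2)) * (norm (o2 t))\<^sup>2 - 2 / \<mu>2 * (norm (o2 t))\<^sup>2"
  proof -
    define q where "q = 1 - (1 - \<rho>)\<^sup>2"
    have q: "q > 0" "(1 - \<rho>)\<^sup>2 = 1 - q" using weight_pos by (simp_all add: q_def)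
    have "(norm (o2 (Suc t)))\<^sup>2 = (1 - q) * (norm (o2 t))\<^sup>2"
      by (simp add: o2_Suc power_mult_distrib flip: q(2))
    then show ?thesis unfolding q_def [symmetric] using \<mu>2 q(1) by (simp add: field_simps)
  qed
  have young: "2 * ((d' - d) \<bullet> o2 t) \<le> \<mu>2 / 2 * (norm (d' - d))\<^sup>2 + 2 / \<mu>2 * (norm (o2 t))\<^sup>2"
    using \<mu>2 by (rule inner_Young)
  have "(2 - \<rho>) * \<mu>1 * (norm r')\<^sup>2 = 2 * (\<mu>1 * (norm r')\<^sup>2) - \<rho> * \<mu>1 * (norm r')\<^sup>2"
    by (simp add: algebra_simps)
  then show ?thesis
    using main z_step a_step d_step o_step young
    unfolding Lyapunov_def aa dd r'_def [symmetric] a_def [symmetric] a'_def [symmetric]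
      d_def [symmetric] d'_def [symmetric]
    by linarith
qed

lemma Lyapunov_terms:
  "0 \<le> (norm (z t - zs))\<^sup>2 / (\<rho> * \<mu>1)" "0 \<le> \<mu>1 * (norm (Pr (K (x t - xs))))\<^sup>2"
  "0 \<le> \<mu>2 * (norm (w t - W xs))\<^sup>2" "0 \<le> 2 / (\<mu>2 * (1 - (1 - \<rho>)\<^sup>2)) * (norm (o2 t))\<^sup>2"
  using \<mu>1 \<mu>2 \<rho>(1) weight_pos by simp_all

lemma Lyapunov_bounds:
  "(norm (z t - zs))\<^sup>2 \<le> \<rho> * \<mu>1 * Lyapunov xs zs t"
  "(norm (Pr (K (x t - xs))))\<^sup>2 \<le> Lyapunov xs zs t / \<mu>1"
  "(norm (w t - W xs))\<^sup>2 \<le> Lyapunov xs zs t / \<mu>2"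
proof -
  have "(norm (z t - zs))\<^sup>2 / (\<rho> * \<mu>1) \<le> Lyapunov xs zs t" "\<mu>1 * (norm (Pr (K (x t - xs))))\<^sup>2 \<le> Lyapunov xs zs t"
    "\<mu>2 * (norm (w t - W xs))\<^sup>2 \<le> Lyapunov xs zs t"
    using Lyapunov_terms(1) [of t zs] Lyapunov_terms(2,3) [of t xs] Lyapunov_terms(4) [of t] unfolding Lyapunov_def by linarith+
  then show "(norm (z t - zs))\<^sup>2 \<le> \<rho> * \<mu>1 * Lyapunov xs zs t"
    "(norm (Pr (K (x t - xs))))\<^sup>2 \<le> Lyapunov xs zs t / \<mu>1"
    "(norm (w t - W xs))\<^sup>2 \<le> Lyapunov xs zs t / \<mu>2"
    using \<mu>1 \<mu>2 \<rho>(1) by (simp_all add: field_simps)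
qed

lemma Lyapunov_nonneg: "0 \<le> Lyapunov xs zs t"
  using Lyapunov_terms(1) [of t zs] Lyapunov_terms(2,3) [of t xs] Lyapunov_terms(4) [of t] unfolding Lyapunov_def by linarith

lemma Lyapunov_decseq:
  assumes "KKT xs zs"
  shows "decseq (Lyapunov xs zs)"
proof (rule decseq_SucI)
  fix t
  have "0 \<le> (2 - \<rho>) * \<mu>1 * (norm (r (Suc t)))\<^sup>2" "0 \<le> \<mu>1 * (norm (Pr (K (x (Suc t) - x t))))\<^sup>2"
    "0 \<le> \<mu>2 / 2 * (norm (w (Suc t) - w t))\<^sup>2" using \<mu>1 \<mu>2 \<rho> by simp_all
  then show "Lyapunov xs zs (Suc t) \<le> Lyapunov xs zs t"
    using Lyapunov_descent [OF assms, of t] by linarith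
qed

end

section \<open>Boundedness, cluster points and convergence for feasible problems\<close>

text \<open>The condition says that the residual of some point lies in the range of the projection,
  so that a suitable \<open>\<Delta>\<tau>\<close> can cancel it.\<close>

locale feasible_proximal_multiplier_method = proximal_multiplier_method +
  assumes feasible: "\<exists>x1. Pr (K x1 - b) = K x1 - b"
begin

interpretation K: linear K by (rule K)
interpretation W: linear W by (rule W)
interpretation Pr: linear Pr by (rule Pr)

lemmas linear_limits = linear_tendsto [OF K] linear_tendsto [OF W] linear_tendsto [OF Pr]
  linear_tendsto [OF Q.linear_axioms]

lemma KKT_pair: obtains xs zs where "KKT xs zs"
  using feasible KKT_exists by (metis Q_def right_minus_eq)

text \<open>Each of the three terms is bounded by the decrease of a convergent Lyapunov
  sequence.\<close>

lemma r_tendsto: "(\<lambda>t. r (Suc t)) \<longlonglongrightarrow> 0"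
  and Pr_step_tendsto: "(\<lambda>t. Pr (K (x (Suc t) - x t))) \<longlonglongrightarrow> 0"
  and w_step_tendsto: "(\<lambda>t. w (Suc t) - w t) \<longlonglongrightarrow> 0"
proof -
  obtain xs zs where kkt: "KKT xs zs" by (rule KKT_pair)
  have "convergent (Lyapunov xs zs)"
    using decseq_convergent [OF Lyapunov_decseq [OF kkt], of 0] Lyapunov_nonneg convergentI by metis
  note * = tendsto_zero_of_power2_norm_le [OF _ _ this]
  have nonneg: "0 \<le> (2 - \<rho>) * \<mu>1 * (norm (r (Suc t)))\<^sup>2" "0 \<le> \<mu>1 * (norm (Pr (K (x (Suc t) - x t))))\<^sup>2"
    "0 \<le> \<mu>2 / 2 * (norm (w (Suc t) - w t))\<^sup>2" for t using \<mu>1 \<mu>2 \<rho> by simp_all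
  have le: "(2 - \<rho>) * \<mu>1 * (norm (r (Suc t)))\<^sup>2 \<le> Lyapunov xs zs t - Lyapunov xs zs (Suc t)"
    "\<mu>1 * (norm (Pr (K (x (Suc t) - x t))))\<^sup>2 \<le> Lyapunov xs zs t - Lyapunov xs zs (Suc t)"
    "\<mu>2 / 2 * (norm (w (Suc t) - w t))\<^sup>2 \<le> Lyapunov xs zs t - Lyapunov xs zs (Suc t)" for t
    using Lyapunov_descent [OF kkt, of t] nonneg [of t] by linarith+
  show "(\<lambda>t. r (Suc t)) \<longlonglongrightarrow> 0"
    by (rule * [OF le(1)]) (use \<mu>1 \<rho> in simp)
  show "(\<lambda>t. Pr (K (x (Suc t) - x t))) \<longlonglongrightarrow> 0"
    by (rule * [OF le(2) \<mu>1])
  show "(\<lambda>t. w (Suc t) - w t) \<longlonglongrightarrow> 0"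
    by (rule * [OF le(3)]) (use \<mu>2 in simp)
qed

lemma bounded_of_power2_le:
  assumes "\<And>t. (norm (g t - a))\<^sup>2 \<le> (B :: real)"
  shows "bounded (range g)"
proof -
  have "norm (g t - a) \<le> sqrt B" for t using assms [of t] by (simp add: real_le_rsqrt)
  then show ?thesis by (auto simp: bounded_def dist_norm norm_minus_commute intro!: exI [of _ a] exI [of _ "sqrt B"])
qed

lemma bounded_z: "bounded (range z)" and bounded_PrK: "bounded (range (\<lambda>t. Pr (K (x t))))"
  and bounded_w: "bounded (range w)"
proof -
  obtain xs zs where kkt: "KKT xs zs" by (rule KKT_pair)
  have le: "Lyapunov xs zs t \<le> Lyapunov xs zs 0" for t
    using decseqD [OF Lyapunov_decseq [OF kkt], of 0 t] by simp
  show "bounded (range z)"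
    by (rule bounded_of_power2_le [of _ zs "\<rho> * \<mu>1 * Lyapunov xs zs 0"])
      (use \<mu>1 \<rho> le in \<open>auto intro!: order_trans [OF Lyapunov_bounds(1) [of _ zs xs]]\<close>)
  show "bounded (range (\<lambda>t. Pr (K (x t))))"
    by (rule bounded_of_power2_le [of _ "Pr (K xs)" "Lyapunov xs zs 0 / \<mu>1"])
      (use \<mu>1 le in \<open>auto intro!: order_trans [OF Lyapunov_bounds(2) [of _ xs zs]] divide_right_mono
          simp flip: K.diff Pr.diff\<close>)
  show "bounded (range w)"
    by (rule bounded_of_power2_le [of _ "W xs" "Lyapunov xs zs 0 / \<mu>2"])
      (use \<mu>2 le in \<open>auto intro!: order_trans [OF Lyapunov_bounds(3) [of _ xs zs]] divide_right_mono\<close>)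
qed

lemma bounded_multiplier: "bounded (range (\<lambda>t. z t + \<mu>1 *\<^sub>R r (Suc t)))"
proof -
  have "bounded (range (\<lambda>t. r (Suc t)))"
    using r_tendsto convergent_imp_bounded by blast
  then have "bounded (range (\<lambda>t. \<mu>1 *\<^sub>R r (Suc t)))"
    using bounded_scaling [of "range (\<lambda>t. r (Suc t))" \<mu>1] by (simp add: image_image)
  with bounded_z show ?thesis by (rule bounded_plus_comp)
qed

text \<open>The Lyapunov function controls only images of \<open>x\<close>. Comparison with a KKT
  point in \<open>optimality\<close> bounds \<open>f (x (Suc t))\<close> up to an error consisting
  of products of bounded and vanishing factors; coercivity then bounds \<open>x\<close>.\<close>

lemma bounded_x: "bounded (range (\<lambda>t. x (Suc t)))"
proof -
  obtain xs zs where kkt: "KKT xs zs" by (rule KKT_pair)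
  define \<eta> where "\<eta> t = (z t + \<mu>1 *\<^sub>R r (Suc t)) \<bullet> (- r (Suc t))
     + \<mu>1 * (Pr (K (xs - x (Suc t))) \<bullet> Pr (K (x (Suc t) - x t)))
     + \<mu>2 * (W (xs - x (Suc t)) \<bullet> (w (Suc t) - w t))" for t
  have f_le: "f (x (Suc t)) \<le> f xs + \<eta> t" for t
  proof -
    have "Q (K (xs - x (Suc t))) = Q (K xs - b) - r (Suc t)"
      by (simp add: r_def K.diff Q.diff)
    then have "Q (K (xs - x (Suc t))) = - r (Suc t)" using kkt by (simp add: KKT_def)
    then show ?thesis using optimality [of xs t] by (simp add: \<eta>_def inner_commute)
  qed
  have "\<eta> \<longlonglongrightarrow> 0"
  proof -
    have "bounded (range (\<lambda>t. Pr (K (x (Suc t)))))" by (rule bounded_subset [OF bounded_PrK]) auto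
    then have "bounded (range (\<lambda>t. Pr (K xs) - Pr (K (x (Suc t)))))"
      by (intro bounded_minus_comp) simp
    then have P: "bounded (range (\<lambda>t. Pr (K (xs - x (Suc t)))))" by (simp add: K.diff Pr.diff)
    have "(\<lambda>t. o2 t /\<^sub>R \<mu>2) \<longlonglongrightarrow> 0 /\<^sub>R \<mu>2" by (intro tendsto_intros o2_tendsto)
    then have "bounded (range (\<lambda>t. o2 t /\<^sub>R \<mu>2))" by (rule convergent_imp_bounded)
    moreover have "bounded (range (\<lambda>t. w (Suc t)))" by (rule bounded_subset [OF bounded_w]) auto
    ultimately have "bounded (range (\<lambda>t. W xs + o2 t /\<^sub>R \<mu>2 - w (Suc t)))"
      by (intro bounded_minus_comp bounded_plus_comp) simp_all
    then have W: "bounded (range (\<lambda>t. W (xs - x (Suc t))))" by (simp add: W.diff w)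
    have "(\<lambda>t. - r (Suc t)) \<longlonglongrightarrow> 0" using tendsto_minus [OF r_tendsto] by simp
    then have "\<eta> \<longlonglongrightarrow> 0 + \<mu>1 * 0 + \<mu>2 * 0"
      unfolding \<eta>_def
      by (intro tendsto_add tendsto_mult tendsto_const
          tendsto_inner_bounded_zero [OF bounded_multiplier] tendsto_inner_bounded_zero [OF P Pr_step_tendsto]
          tendsto_inner_bounded_zero [OF W w_step_tendsto])
    then show ?thesis by simp
  qed
  then have "bounded (range \<eta>)" by (rule convergent_imp_bounded)
  then obtain B where B: "\<And>t. \<bar>\<eta> t\<bar> \<le> B" by (auto simp: bounded_iff)
  have "norm (x (Suc t)) \<le> (f xs + B) / c" for t
  proof -
    have "c * norm (x (Suc t)) \<le> f xs + B"
      using coercive [of "x (Suc t)"] f_le [of t] B [of t] by linarith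
    then show ?thesis using c by (simp add: pos_le_divide_eq mult.commute)
  qed
  then show ?thesis unfolding bounded_iff by blast
qed

text \<open>Pass to the limit in \<open>optimality\<close>: the proximal terms vanish, and
  \<open>f\<close> is continuous.\<close>

lemma cluster_point_KKT:
  assumes s: "strict_mono s" and xl: "(\<lambda>k. x (Suc (s k))) \<longlonglongrightarrow> xb" and zl: "(\<lambda>k. z (Suc (s k))) \<longlonglongrightarrow> zb"
  shows "KKT xb zb" "Q zb = zb"
proof -
  have sub: "(\<lambda>k. g (s k)) \<longlonglongrightarrow> l" if "g \<longlonglongrightarrow> l" for g :: "nat \<Rightarrow> 'z::topological_space" and l
    using LIMSEQ_subseq_LIMSEQ [OF that s] by (simp add: o_def)
  have cont: "(\<lambda>k. f (x (Suc (s k)))) \<longlonglongrightarrow> f xb"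
    using convex_on_continuous [OF open_UNIV convex]
    by (intro isCont_tendsto_compose [OF _ xl]) (simp add: continuous_on_eq_continuous_at)
  have "(\<lambda>k. Q (K (x (Suc (s k))) - b)) \<longlonglongrightarrow> Q (K xb - b)"
    by (intro linear_limits tendsto_diff xl tendsto_const)
  moreover have "(\<lambda>k. Q (K (x (Suc (s k))) - b)) \<longlonglongrightarrow> 0"
    using sub [OF r_tendsto] by (simp add: r_def)
  ultimately have feas: "Q (K xb - b) = 0" by (rule LIMSEQ_unique)
  have "(\<lambda>k. Q (z (Suc (s k)))) \<longlonglongrightarrow> Q zb" by (intro linear_limits zl)
  then have "(\<lambda>k. z (Suc (s k))) \<longlonglongrightarrow> Q zb" by (simp add: z_def)
  then show "Q zb = zb" using zl by (rule LIMSEQ_unique)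
  \<comment> \<open>The multiplier in \<open>optimality\<close> has step length
    \<open>\<mu>1\<close>, whereas \<open>z (Suc t)\<close> uses \<open>\<rho> * \<mu>1\<close>;
    their difference is a multiple of the vanishing residual.\<close>
  have "z t + \<mu>1 *\<^sub>R r (Suc t) = z (Suc t) + (\<mu>1 - \<rho> * \<mu>1) *\<^sub>R r (Suc t)" for t
    unfolding z_Suc scaleR_left_diff_distrib by simp
  moreover have "(\<lambda>k. z (Suc (s k)) + (\<mu>1 - \<rho> * \<mu>1) *\<^sub>R r (Suc (s k))) \<longlonglongrightarrow> zb + (\<mu>1 - \<rho> * \<mu>1) *\<^sub>R 0"
    by (intro tendsto_intros zl sub [OF r_tendsto])
  ultimately have zr: "(\<lambda>k. z (s k) + \<mu>1 *\<^sub>R r (Suc (s k))) \<longlonglongrightarrow> zb" by simp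
  have "f xb \<le> f y + zb \<bullet> Q (K (y - xb))" for y
  proof -
    have "(\<lambda>k. f y - f (x (Suc (s k))) + (z (s k) + \<mu>1 *\<^sub>R r (Suc (s k))) \<bullet> Q (K (y - x (Suc (s k))))
       + \<mu>1 * (Pr (K (x (Suc (s k)) - x (s k))) \<bullet> Pr (K (y - x (Suc (s k)))))
       + \<mu>2 * ((w (Suc (s k)) - w (s k)) \<bullet> W (y - x (Suc (s k)))))
      \<longlonglongrightarrow> f y - f xb + zb \<bullet> Q (K (y - xb)) + \<mu>1 * (0 \<bullet> Pr (K (y - xb))) + \<mu>2 * (0 \<bullet> W (y - xb))"
      by (intro tendsto_intros cont zr linear_limits xl
          sub [OF Pr_step_tendsto] sub [OF w_step_tendsto])
    then have "0 \<le> f y - f xb + zb \<bullet> Q (K (y - xb)) + \<mu>1 * (0 \<bullet> Pr (K (y - xb))) + \<mu>2 * (0 \<bullet> W (y - xb))"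
      by (rule LIMSEQ_le_const) (use optimality in blast)
    then show ?thesis by simp
  qed
  then show "KKT xb zb" using feas by (simp add: KKT_def)
qed

text \<open>Based at a KKT cluster point, the Lyapunov function tends to 0 along a subsequence and,
  being decreasing, altogether. Convergence of \<open>x\<close> itself is not claimed; instead all
  its cluster points share the multiplier \<open>zb\<close>.\<close>

theorem converges:
  obtains xb zb where "KKT xb zb" "Pr zb = 0" "o1 \<longlonglongrightarrow> zb"
    "(\<lambda>t. K (x t)) \<longlonglongrightarrow> K xb" "(\<lambda>t. W (x t)) \<longlonglongrightarrow> W xb"
    "\<And>s y. strict_mono s \<Longrightarrow> (\<lambda>k. x (Suc (s k))) \<longlonglongrightarrow> y \<Longrightarrow> KKT y zb"
proof -
  have "bounded (range (\<lambda>t. (x (Suc t), z (Suc t))))"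
    by (rule bounded_subset [OF bounded_Times [OF bounded_x bounded_subset [OF bounded_z]]]) auto
  then obtain s l where s: "strict_mono s" and l: "(\<lambda>k. (x (Suc (s k)), z (Suc (s k)))) \<longlonglongrightarrow> l"
    using bounded_imp_convergent_subsequence unfolding o_def by blast
  obtain xb zb where xz: "l = (xb, zb)" by (cases l)
  have xl: "(\<lambda>k. x (Suc (s k))) \<longlonglongrightarrow> xb" and zl: "(\<lambda>k. z (Suc (s k))) \<longlonglongrightarrow> zb"
    using tendsto_fst [OF l] tendsto_snd [OF l] by (simp_all add: xz)
  have kkt: "KKT xb zb" and Qz: "Q zb = zb" using cluster_point_KKT [OF s xl zl] .
  have sub: "(\<lambda>k. g (s k)) \<longlonglongrightarrow> l" if "g \<longlonglongrightarrow> l" for g :: "nat \<Rightarrow> 'z::topological_space" and l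
    using LIMSEQ_subseq_LIMSEQ [OF that s] by (simp add: o_def)
  define \<Phi> where "\<Phi> = Lyapunov xb zb"
  have "(\<lambda>k. W (x (Suc (s k))) + o2 (s k) /\<^sub>R \<mu>2) \<longlonglongrightarrow> W xb + 0 /\<^sub>R \<mu>2"
    by (intro tendsto_intros linear_limits xl sub o2_tendsto)
  then have wl: "(\<lambda>k. w (Suc (s k))) \<longlonglongrightarrow> W xb" by (simp add: w)
  have "(\<lambda>k. \<Phi> (Suc (s k))) \<longlonglongrightarrow> (norm (zb - zb))\<^sup>2 / (\<rho> * \<mu>1) + \<mu>1 * (norm (Pr (K (xb - xb))))\<^sup>2
     + \<mu>2 * (norm (W xb - W xb))\<^sup>2 + 2 / (\<mu>2 * (1 - (1 - \<rho>)\<^sup>2)) * (norm (0 :: 'c))\<^sup>2"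
    unfolding \<Phi>_def Lyapunov_def
    by (intro tendsto_intros linear_limits zl xl wl sub LIMSEQ_Suc [OF o2_tendsto])
      (use \<rho> \<mu>1 in auto)
  then have "(\<lambda>k. \<Phi> (Suc (s k))) \<longlonglongrightarrow> 0" by (simp add: K.zero Pr.zero)
  moreover obtain \<phi> where \<phi>: "\<Phi> \<longlonglongrightarrow> \<phi>"
    using decseq_convergent [OF Lyapunov_decseq [OF kkt], of 0] Lyapunov_nonneg \<Phi>_def by metis
  then have "(\<lambda>k. \<Phi> (Suc (s k))) \<longlonglongrightarrow> \<phi>" by (intro sub LIMSEQ_Suc)
  ultimately have \<Phi>0: "\<Phi> \<longlonglongrightarrow> 0" using \<phi> LIMSEQ_unique by blast
  have conv: "g \<longlonglongrightarrow> a" if "\<And>t. (norm (g t - a))\<^sup>2 \<le> C * \<Phi> t" for g :: "nat \<Rightarrow> 'z::real_normed_vector" and a C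
  proof -
    have lim: "(\<lambda>t. C * \<Phi> t) \<longlonglongrightarrow> C * 0" by (intro tendsto_intros \<Phi>0)
    have "(\<lambda>t. (norm (g t - a))\<^sup>2) \<longlonglongrightarrow> 0"
      by (rule tendsto_sandwich [OF _ _ tendsto_const]) (use that lim in auto)
    then show ?thesis by (simp add: tendsto_norm_zero_iff LIM_zero_iff)
  qed
  have z: "z \<longlonglongrightarrow> zb"
    by (rule conv [of _ _ "\<rho> * \<mu>1"]) (simp add: \<Phi>_def Lyapunov_bounds)
  have PrK: "(\<lambda>t. Pr (K (x t))) \<longlonglongrightarrow> Pr (K xb)"
    by (rule conv [of _ _ "1 / \<mu>1"]) (use Lyapunov_bounds(2) [of _ xb zb] in \<open>simp add: \<Phi>_def K.diff Pr.diff\<close>)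
  have wlim: "w \<longlonglongrightarrow> W xb"
    by (rule conv [of _ _ "1 / \<mu>2"]) (use Lyapunov_bounds(3) [of _ xb zb] in \<open>simp add: \<Phi>_def\<close>)
  show thesis
  proof
    show "KKT xb zb" by fact
    show "Pr zb = 0" using Qz by (simp add: Q_def)
    have "(\<lambda>t. Pr (o1 t) + z t) \<longlonglongrightarrow> 0 + zb" by (intro tendsto_add Pr_o1_tendsto z)
    then show "o1 \<longlonglongrightarrow> zb" by (simp add: z_def Pr_plus_Q)
    have "(\<lambda>t. Pr (K (x (Suc t))) + (r (Suc t) + Q b)) \<longlonglongrightarrow> Pr (K xb) + (0 + Q b)"
      by (intro tendsto_intros LIMSEQ_Suc [OF PrK] r_tendsto)
    moreover have "Q b = Q (K xb)" using kkt by (simp add: KKT_def Q.diff)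
    moreover have "r (Suc t) + Q b = Q (K (x (Suc t)))" for t by (simp add: r_def Q.diff)
    ultimately have "(\<lambda>t. K (x (Suc t))) \<longlonglongrightarrow> K xb" by (simp add: Pr_plus_Q)
    then show "(\<lambda>t. K (x t)) \<longlonglongrightarrow> K xb" by (rule LIMSEQ_imp_Suc)
    have "(\<lambda>t. w (Suc t) - o2 t /\<^sub>R \<mu>2) \<longlonglongrightarrow> W xb - 0 /\<^sub>R \<mu>2"
      by (intro tendsto_intros LIMSEQ_Suc [OF wlim] o2_tendsto)
    then have "(\<lambda>t. W (x (Suc t))) \<longlonglongrightarrow> W xb" by (simp add: w)
    then show "(\<lambda>t. W (x t)) \<longlonglongrightarrow> W xb" by (rule LIMSEQ_imp_Suc)
    fix s y assume "strict_mono s" "(\<lambda>k. x (Suc (s k))) \<longlonglongrightarrow> y"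
    moreover have "(\<lambda>k. z (Suc (s k))) \<longlonglongrightarrow> zb"
      using LIMSEQ_subseq_LIMSEQ [OF LIMSEQ_Suc [OF z] \<open>strict_mono s\<close>] by (simp add: o_def)
    ultimately show "KKT y zb" by (rule cluster_point_KKT(1))
  qed
qed

end


section \<open>Convergence of the algorithm\<close>

lemma linear_fold3: "linear fold3"
  by (rule linearI) (simp_all add: fold3_def vec_eq_iff)

lemma linear_unfold3: "linear unfold3"
  by (rule linearI) (simp_all add: unfold3_def vec_eq_iff)

lemma linear_transpose: "linear (transpose :: real^'n^'m \<Rightarrow> real^'m^'n)"
  by (rule linearI) (simp_all add: transpose_def vec_eq_iff)

lemma linear_matrix_mult_left: "linear (\<lambda>X. (A :: real^'n^'m) ** (X :: real^'k^'n))"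
  by (rule linearI)
    (simp_all add: matrix_matrix_mult_def vec_eq_iff distrib_left sum.distrib sum_distrib_left mult.left_commute)

lemma linear_matrix_mult_right: "linear (\<lambda>X. (X :: real^'n^'m) ** (A :: real^'k^'n))"
  by (rule linearI)
    (simp_all add: matrix_matrix_mult_def vec_eq_iff distrib_right sum.distrib sum_distrib_left mult.assoc)

lemmas linear_compose_app = linear_compose [unfolded o_def]

lemma linear_mode3: "linear (\<lambda>X. X \<times>\<^sub>3 D)"
  unfolding mode3_def
  by (intro linear_compose_app [OF _ linear_fold3] linear_compose_app [OF linear_unfold3] linear_matrix_mult_left)

lemma linear_H_spa_mode3: "linear (\<lambda>L. H_spa P (L \<times>\<^sub>3 D))"
proof -
  have "linear (H_spa P)"
    unfolding H_spa_def
    by (intro linear_compose_app [OF _ linear_fold3] linear_compose_app [OF _ linear_matrix_mult_right]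
        linear_unfold3)
  then show ?thesis by (rule linear_compose_app [OF linear_mode3])
qed

lemma linear_H_spec_mode3: "linear (\<lambda>L. H_spec P (L \<times>\<^sub>3 D))"
proof -
  have "linear (H_spec P)"
    unfolding H_spec_def
    by (intro linear_compose_app [OF _ linear_fold3] linear_compose_app [OF linear_unfold3]
        linear_matrix_mult_left)
  then show ?thesis by (rule linear_compose_app [OF linear_mode3])
qed

lemma linear_J_op: "linear (J_op P)"
  unfolding J_op_def
  by (intro linear_compose_app [OF _ linear_fold3] linear_compose_app [OF _ linear_transpose]
      linear_compose_sum ballI linear_compose_app [OF linear_matrix_mult_left linear_matrix_mult_right])

section \<open>The least-squares blocks\<close>

text \<open>The pseudoinverse selection is affine in the observation and the multiplier, hence
  continuous. Arbitrary minimizers could drift in the kernel of the Jacobian operator.\<close>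

lemma dtau_ls_tendsto:
  assumes "(\<lambda>t. H_spa P (L t \<times>\<^sub>3 Dict P)) \<longlonglongrightarrow> u" and "O1 \<longlonglongrightarrow> v"
  obtains d where "(\<lambda>t. dtau_ls P \<mu>1 (L t) (O1 t)) \<longlonglongrightarrow> d"
proof -
  define G where "G u = (\<Sum>i\<in>UNIV. pinv (Jac P i) ** transpose (unfold3 u) ** eps_outer i)" for u
  have "linear G"
    unfolding G_def
    by (intro linear_compose_sum ballI linear_compose_app [OF linear_unfold3]
        linear_compose_app [OF linear_transpose]
        linear_compose_app [OF linear_matrix_mult_left linear_matrix_mult_right])
  then have "(\<lambda>t. G (H_spa P (L t \<times>\<^sub>3 Dict P) + (1 / \<mu>1) *\<^sub>R O1 t - Ywarp P)) \<longlonglongrightarrow> G (u + (1 / \<mu>1) *\<^sub>R v - Ywarp P)"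
    by (rule linear_tendsto) (intro tendsto_intros assms)
  then show thesis using that by (simp add: dtau_ls_def G_def)
qed

lemma AB_ls_tendsto:
  fixes P :: "('M::finite, 'N::finite, 'H::finite, 'm::finite, 'n::finite, 'h::finite, 'l::finite, 'p::finite) data"
  assumes W: "(\<lambda>t. H_spec P (L t \<times>\<^sub>3 Dict P)) \<longlonglongrightarrow> u" and O2: "O2 \<longlonglongrightarrow> v"
    and AB: "\<And>t. hcat (A t) (unfold3 (B t)) = AB_ls P \<mu>2 (L t) (O2 t)"
  obtains a b where "A \<longlonglongrightarrow> a" "B \<longlonglongrightarrow> b"
proof -
  define G where "G u = unfold3 u ** pinv (vcat (unfold3 (Zdata P)) (mat 1))" for u :: "('M, 'N, 'h) tensor"
  have "linear G"
    unfolding G_def by (intro linear_compose_app [OF linear_unfold3] linear_matrix_mult_right)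
  then have "(\<lambda>t. G (H_spec P (L t \<times>\<^sub>3 Dict P) + (1 / \<mu>2) *\<^sub>R O2 t)) \<longlonglongrightarrow> G (u + (1 / \<mu>2) *\<^sub>R v)"
    by (rule linear_tendsto) (intro tendsto_intros W O2)
  moreover have "G (H_spec P (L t \<times>\<^sub>3 Dict P) + (1 / \<mu>2) *\<^sub>R O2 t) = hcat (A t) (unfold3 (B t))" for t
    unfolding AB AB_ls_def G_def H_spec_def mode3_def
    by (simp add: linear_add [OF linear_unfold3] linear_scale [OF linear_unfold3] matrix_mul_assoc)
  ultimately obtain C where C: "(\<lambda>t. hcat (A t) (unfold3 (B t))) \<longlonglongrightarrow> C" by auto
  then have lim: "(\<lambda>t. hcat (A t) (unfold3 (B t)) $ i $ q) \<longlonglongrightarrow> C $ i $ q" for i q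
    by (intro tendsto_vec_nth)
  show thesis
  proof
    show "A \<longlonglongrightarrow> (\<chi> i j. C $ i $ Inl j)"
      using lim [of _ "Inl _"] by (intro vec_tendstoI) (simp add: hcat_def)
    show "B \<longlonglongrightarrow> (\<chi> i j k. C $ k $ Inr (i, j))"
      using lim [of _ "Inr (_, _)"] by (intro vec_tendstoI) (simp add: hcat_def unfold3_def)
  qed
qed

lemma dtau_arg_min_least_squares:
  assumes "is_arg_min (\<lambda>x. aug_lagrangian P \<mu>1 \<mu>2 L x A B O1 O2) (\<lambda>_. True) d" and "0 < \<mu>1"
  shows "norm (H_spa P (L \<times>\<^sub>3 Dict P) - Ywarp P + O1 /\<^sub>R \<mu>1 - J_op P d)
    \<le> norm (H_spa P (L \<times>\<^sub>3 Dict P) - Ywarp P + O1 /\<^sub>R \<mu>1 - J_op P y)"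
proof -
  have res: "res1 P L y + (1 / \<mu>1) *\<^sub>R O1 = H_spa P (L \<times>\<^sub>3 Dict P) - Ywarp P + O1 /\<^sub>R \<mu>1 - J_op P y" for y
    by (simp add: res1_def divide_inverse)
  have "aug_lagrangian P \<mu>1 \<mu>2 L d A B O1 O2 \<le> aug_lagrangian P \<mu>1 \<mu>2 L y A B O1 O2"
    using assms(1) by (auto simp: is_arg_min_def not_less)
  then show ?thesis using assms(2) unfolding aug_lagrangian_def res by simp
qed

text \<open>Since \<open>B\<close> is unconstrained, the second penalty term can be made to vanish.\<close>

lemma AB_arg_min_residual:
  assumes "is_arg_min (\<lambda>(X, Y). aug_lagrangian P \<mu>1 \<mu>2 L d X Y O1 O2) (\<lambda>_. True) (A, B)" and "0 < \<mu>2"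
  shows "Zdata P \<times>\<^sub>3 A + B = H_spec P (L \<times>\<^sub>3 Dict P) + O2 /\<^sub>R \<mu>2"
proof -
  define e where "e = res2 P L A B + (1 / \<mu>2) *\<^sub>R O2"
  have "aug_lagrangian P \<mu>1 \<mu>2 L d A B O1 O2 \<le> aug_lagrangian P \<mu>1 \<mu>2 L d A (B + e) O1 O2"
    using assms(1) by (auto simp: is_arg_min_def not_less)
  moreover have "res2 P L A (B + e) + (1 / \<mu>2) *\<^sub>R O2 = 0" by (simp add: e_def res2_def)
  ultimately have "\<mu>2 / 2 * (norm e)\<^sup>2 \<le> 0" by (simp add: aug_lagrangian_def e_def)
  then have "e = 0" using assms(2) by (simp add: mult_le_0_iff)
  then show ?thesis by (simp add: e_def res2_def divide_inverse algebra_simps)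
qed

text \<open>Feasibility supplies a KKT pair. \<open>K\<close> and \<open>W\<close> may have a common
  kernel, invisible to the penalties; \<open>L_determined\<close> is what singles out one cluster
  point of \<open>L\<close>.\<close>

theorem theorem4p2:
  fixes P :: "('M::{finite, linorder}, 'N::{finite, linorder}, 'H::finite, 'm::finite, 'n::finite,
               'h::finite, 'l::{finite, linorder}, 'p::finite) data"
    and \<mu>1 \<mu>2 \<rho> :: real
    and L :: "nat \<Rightarrow> ('M, 'N, 'l) tensor"
    and \<Delta>half \<Delta> :: "nat \<Rightarrow> real^'H^'p"
    and A :: "nat \<Rightarrow> real^'h^'h"
    and B :: "nat \<Rightarrow> ('M, 'N, 'h) tensor"
    and O1 :: "nat \<Rightarrow> ('m, 'n, 'H) tensor"
    and O2 :: "nat \<Rightarrow> ('M, 'N, 'h) tensor"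
  assumes "CARD('m) < CARD('M)" and "CARD('n) < CARD('N)" and "CARD('h) < CARD('H)"
    and "circular_convolution (Blur P)"
    and "downsampling (Down P)"
    and "transpose (Dict P) ** Dict P = mat 1"
    and "0 < \<rho>" and "\<rho> < (1 + sqrt 5) / 2"
    and "0 < \<mu>1" and "0 < \<mu>2"
    and feasible: "\<exists>x. primal_feasible P x"
    and L_determined: "\<And>X X' d a b. primal_optimal P (X, d, a, b) \<Longrightarrow>
           primal_optimal P (X', d, a, b) \<Longrightarrow> X = X'"
    and "sgs_admm P \<mu>1 \<mu>2 \<rho> L \<Delta>half \<Delta> A B O1 O2"
  shows "(\<exists>x. primal_optimal P x \<and> (\<lambda>t. (L t, \<Delta> t, A t, B t)) \<longlonglongrightarrow> x) \<and>
         (\<exists>y. dual_optimal P y \<and> (\<lambda>t. (O1 t, O2 t)) \<longlonglongrightarrow> y)"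
proof -
  note alg = \<open>sgs_admm P \<mu>1 \<mu>2 \<rho> L \<Delta>half \<Delta> A B O1 O2\<close> [unfolded sgs_admm_def, rule_format]
  define K where "K X = H_spa P (X \<times>\<^sub>3 Dict P)" for X
  define W where "W X = H_spec P (X \<times>\<^sub>3 Dict P)" for X
  define J where "J = J_op P"
  have linK: "linear K" unfolding K_def by (rule linear_H_spa_mode3)
  have linW: "linear W" unfolding W_def by (rule linear_H_spec_mode3)
  have linJ: "linear J" unfolding J_def by (rule linear_J_op)
  have sub: "subspace (range J)" by (intro linear_subspace_image linJ subspace_UNIV)
  obtain Pr where Pr: "linear Pr" "\<And>u. Pr u \<in> range J" "\<And>u s. s \<in> range J \<Longrightarrow> s \<bullet> (u - Pr u) = 0"
    using orthogonal_projection_exists [OF sub] by blast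
  have PrJ: "Pr (J d) = J d" for d
    by (rule orthogonal_projection_eqI [OF sub Pr(2,3)]) auto
  have idem: "Pr (Pr u) = Pr u" for u using Pr(2) [of u] PrJ by auto
  note selfadjoint = orthogonal_projection_selfadjoint [OF Pr(2,3)]
  \<comment> \<open>By the normal equations, \<open>J d\<close> is the same projection for every
    minimizer \<open>d\<close>.\<close>
  have Pr_least_squares: "J d = Pr (K X - Ywarp P + o1 /\<^sub>R \<mu>1)"
    if "is_arg_min (\<lambda>x. aug_lagrangian P \<mu>1 \<mu>2 X x a b o1 o2) (\<lambda>_. True) d" for X d a b o1 o2
  proof (rule orthogonal_projection_eqI [OF sub Pr(2,3), symmetric])
    fix s assume "s \<in> range J"
    then obtain e where "s = J e" by auto
    then show "s \<bullet> (K X - Ywarp P + o1 /\<^sub>R \<mu>1 - J d) = 0"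
      using least_squares_normal_equation [OF linJ, of "K X - Ywarp P + o1 /\<^sub>R \<mu>1" d e]
        dtau_arg_min_least_squares [OF that \<open>0 < \<mu>1\<close>]
      by (simp add: K_def J_def inner_commute)
  qed auto
  define w where "w t = Zdata P \<times>\<^sub>3 A t + B t" for t
  have w_Suc: "w (Suc t) = W (L (Suc t)) + O2 t /\<^sub>R \<mu>2" for t
    using AB_arg_min_residual [OF _ \<open>0 < \<mu>2\<close>] alg [of t] unfolding w_def W_def by blast
  have J_Suc: "J (\<Delta> (Suc t)) = Pr (K (L (Suc t)) - Ywarp P + O1 t /\<^sub>R \<mu>1)" for t
    using Pr_least_squares alg [of t] by blast
  obtain c :: real where c: "0 < c" "\<And>X :: ('M, 'N, 'l) tensor. c * norm X \<le> tnn X"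
    using tnn_coercive by blast
  \<comment> \<open>The golden ratio is below 2, the range covered by the Lyapunov argument.\<close>
  have "sqrt 5 \<le> 3" by (rule real_le_lsqrt) simp_all
  then have "\<rho> < 2" using \<open>\<rho> < (1 + sqrt 5) / 2\<close> by simp
  interpret admm: feasible_proximal_multiplier_method tnn K W Pr "Ywarp P" c \<mu>1 \<mu>2 \<rho> L
    "\<lambda>t. J (\<Delta> t)" "\<lambda>t. J (\<Delta>half t)" O1 w O2
  proof
    fix t :: nat and X :: "('M, 'N, 'l) tensor"
    show "J (\<Delta>half t) = Pr (K (L t) - Ywarp P + O1 t /\<^sub>R \<mu>1)"
      using Pr_least_squares alg [of t] by blast
    have "aug_lagrangian P \<mu>1 \<mu>2 (L (Suc t)) (\<Delta>half t) (A t) (B t) (O1 t) (O2 t)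
        \<le> aug_lagrangian P \<mu>1 \<mu>2 X (\<Delta>half t) (A t) (B t) (O1 t) (O2 t)"
      using alg [of t] by (auto simp: is_arg_min_def not_less)
    moreover have "res1 P X (\<Delta>half t) + (1 / \<mu>1) *\<^sub>R O1 t = K X + (O1 t /\<^sub>R \<mu>1 - Ywarp P - J (\<Delta>half t))"
      "res2 P X (A t) (B t) + (1 / \<mu>2) *\<^sub>R O2 t = W X + (O2 t /\<^sub>R \<mu>2 - w t)" for X
      by (simp_all add: res1_def res2_def K_def W_def J_def w_def divide_inverse)
    ultimately show "tnn (L (Suc t))
         + \<mu>1 / 2 * (norm (K (L (Suc t)) + (O1 t /\<^sub>R \<mu>1 - Ywarp P - J (\<Delta>half t))))\<^sup>2
         + \<mu>2 / 2 * (norm (W (L (Suc t)) + (O2 t /\<^sub>R \<mu>2 - w t)))\<^sup>2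
       \<le> tnn X + \<mu>1 / 2 * (norm (K X + (O1 t /\<^sub>R \<mu>1 - Ywarp P - J (\<Delta>half t))))\<^sup>2
         + \<mu>2 / 2 * (norm (W X + (O2 t /\<^sub>R \<mu>2 - w t)))\<^sup>2"
      by (simp add: aug_lagrangian_def)
    show "O1 (Suc t) = O1 t + (\<rho> * \<mu>1) *\<^sub>R (K (L (Suc t)) - Ywarp P - J (\<Delta> (Suc t)))"
      using alg [of t] by (simp add: res1_def K_def J_def diff_diff_eq)
    show "O2 (Suc t) = O2 t + (\<rho> * \<mu>2) *\<^sub>R (W (L (Suc t)) - w (Suc t))"
      using alg [of t] by (simp add: res2_def W_def w_def)
  next
    obtain X d a b where "primal_feasible P (X, d, a, b)" using feasible by auto
    then have "K X - Ywarp P = J d" by (simp add: primal_feasible_def K_def J_def)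
    then show "\<exists>X. Pr (K X - Ywarp P) = K X - Ywarp P" using PrJ by metis
  qed (use convex_tnn c idem selfadjoint J_Suc w_Suc \<open>0 < \<mu>1\<close> \<open>0 < \<mu>2\<close> \<open>0 < \<rho>\<close> \<open>\<rho> < 2\<close>
      linear_add [OF linK] linear_add [OF linW] linear_add [OF Pr(1)]
      linear_scale [OF linK] linear_scale [OF linW] linear_scale [OF Pr(1)] in auto)
  obtain xb zb where kkt: "admm.KKT xb zb" and Prz: "Pr zb = 0" and O1: "O1 \<longlonglongrightarrow> zb"
    and Klim: "(\<lambda>t. K (L t)) \<longlonglongrightarrow> K xb" and Wlim: "(\<lambda>t. W (L t)) \<longlonglongrightarrow> W xb"
    and cluster: "\<And>s X. strict_mono s \<Longrightarrow> (\<lambda>k. L (Suc (s k))) \<longlonglongrightarrow> X \<Longrightarrow> admm.KKT X zb"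
    using admm.converges by metis
  note O2 = admm.o2_tendsto
  \<comment> \<open>The initial point is arbitrary and the least-squares formulas hold from index 1
    on, hence the shift.\<close>
  have "\<Delta> (Suc t) = dtau_ls P \<mu>1 (L (Suc t)) (O1 t)" for t using alg by blast
  then obtain db where db: "(\<lambda>t. \<Delta> (Suc t)) \<longlonglongrightarrow> db"
    using dtau_ls_tendsto [of P "\<lambda>t. L (Suc t)", OF LIMSEQ_Suc [OF Klim, unfolded K_def] O1, of \<mu>1] by auto
  have AB: "hcat (A (Suc t)) (unfold3 (B (Suc t))) = AB_ls P \<mu>2 (L (Suc t)) (O2 t)" for t using alg by blast
  obtain ab bb where ab: "(\<lambda>t. A (Suc t)) \<longlonglongrightarrow> ab" and bb: "(\<lambda>t. B (Suc t)) \<longlonglongrightarrow> bb"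
    by (rule AB_ls_tendsto [OF LIMSEQ_Suc [OF Wlim, unfolded W_def] O2 AB])
  \<comment> \<open>In the limit the multiplier drops out because \<open>Pr zb = 0\<close>, and KKT
    feasibility makes the projection act as the identity.\<close>
  have Jdb: "J db = K xb - Ywarp P"
  proof (rule LIMSEQ_unique)
    show "(\<lambda>t. J (\<Delta> (Suc t))) \<longlonglongrightarrow> J db" by (rule linear_tendsto [OF linJ db])
    have "(\<lambda>t. J (\<Delta> (Suc t))) \<longlonglongrightarrow> Pr (K xb - Ywarp P + zb /\<^sub>R \<mu>1)"
      unfolding J_Suc by (intro linear_tendsto [OF Pr(1)] tendsto_intros LIMSEQ_Suc [OF Klim] O1)
    also have "Pr (K xb - Ywarp P + zb /\<^sub>R \<mu>1) = Pr (K xb - Ywarp P)"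
      by (simp add: linear_add [OF Pr(1)] linear_scale [OF Pr(1)] Prz)
    also have "\<dots> = K xb - Ywarp P" using kkt by (simp add: admm.KKT_def admm.Q_def)
    finally show "(\<lambda>t. J (\<Delta> (Suc t))) \<longlonglongrightarrow> K xb - Ywarp P" .
  qed
  have Wxb: "Zdata P \<times>\<^sub>3 ab + bb = W xb"
  proof (rule LIMSEQ_unique)
    have "linear (\<lambda>a. Zdata P \<times>\<^sub>3 a)"
      unfolding mode3_def
      by (intro linear_compose_app [OF _ linear_fold3] linear_matrix_mult_right)
    then show "(\<lambda>t. w (Suc t)) \<longlonglongrightarrow> Zdata P \<times>\<^sub>3 ab + bb"
      unfolding w_def by (intro tendsto_add bb linear_tendsto [OF _ ab])
    have "(\<lambda>t. w (Suc t)) \<longlonglongrightarrow> W xb + 0 /\<^sub>R \<mu>2"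
      unfolding w_Suc by (intro tendsto_intros LIMSEQ_Suc [OF Wlim] O2)
    then show "(\<lambda>t. w (Suc t)) \<longlonglongrightarrow> W xb" by simp
  qed
  \<comment> \<open>Orthogonality to the range of \<open>J\<close> is dual feasibility: the
    Lagrangian does not depend on \<open>\<Delta>\<tau>\<close> at this multiplier.\<close>
  have zbJ: "zb \<bullet> J d = 0" for d using selfadjoint [of zb "J d"] by (simp add: Prz PrJ)
  have zbQ: "zb \<bullet> admm.Q u = zb \<bullet> u" for u
    using selfadjoint [of zb u] by (simp add: admm.Q_def inner_diff_right Prz)
  \<comment> \<open>A lower bound for the Lagrangian at \<open>(zb, 0)\<close>. For a feasible point
    the bracket is 0, giving primal optimality; for arbitrary arguments it gives dual
    optimality.\<close>
  have lower: "tnn X \<le> tnn Y + zb \<bullet> (K Y - Ywarp P - J d)" if "admm.KKT X zb" "K X = K xb" for X Y d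
  proof -
    have "tnn X \<le> tnn Y + zb \<bullet> (K Y - K X)"
      using that(1) by (simp add: admm.KKT_def zbQ linear_diff [OF linK])
    also have "zb \<bullet> (K Y - K X) = zb \<bullet> (K Y - Ywarp P) - zb \<bullet> (K xb - Ywarp P)"
      by (simp add: that(2) inner_diff_right)
    also have "\<dots> = zb \<bullet> (K Y - Ywarp P - J d)"
      unfolding Jdb [symmetric] inner_diff_right [of _ _ "J d"] zbJ ..
    finally show ?thesis .
  qed
  \<comment> \<open>Stated for all KKT points with the images of \<open>xb\<close>, so that cluster
    points of \<open>L\<close> share the remaining blocks and \<open>L_determined\<close>
    applies.\<close>
  have optimal: "primal_optimal P (X, db, ab, bb)" if "admm.KKT X zb" "K X = K xb" "W X = W xb" for X
    unfolding primal_optimal_def is_arg_min_linorder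
  proof (intro conjI allI impI)
    show "primal_feasible P (X, db, ab, bb)"
      using that(2,3) Jdb Wxb by (simp add: primal_feasible_def K_def W_def J_def)
    fix y assume y: "primal_feasible P y"
    obtain Y d a b where "y = (Y, d, a, b)" by (cases y)
    then show "(case (X, db, ab, bb) of (L, \<Delta>, A, B) \<Rightarrow> tnn L) \<le> (case y of (L, \<Delta>, A, B) \<Rightarrow> tnn L)"
      using lower [OF that(1,2), of Y d] y by (simp add: primal_feasible_def K_def J_def)
  qed
  have xb: "primal_optimal P (xb, db, ab, bb)" using optimal [OF kkt] by simp
  have "(\<lambda>t. L (Suc t)) \<longlonglongrightarrow> xb"
  proof (rule bounded_unique_cluster_point_tendsto [OF admm.bounded_x])
    fix s :: "nat \<Rightarrow> nat" and X
    assume s: "strict_mono s" and "((\<lambda>t. L (Suc t)) \<circ> s) \<longlonglongrightarrow> X"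
    then have X: "(\<lambda>k. L (Suc (s k))) \<longlonglongrightarrow> X" by (simp add: o_def)
    have "K X = K xb"
      using LIMSEQ_unique linear_tendsto [OF linK X] LIMSEQ_subseq_LIMSEQ [OF LIMSEQ_Suc [OF Klim] s]
      by (fastforce simp: o_def)
    moreover have "W X = W xb"
      using LIMSEQ_unique linear_tendsto [OF linW X] LIMSEQ_subseq_LIMSEQ [OF LIMSEQ_Suc [OF Wlim] s]
      by (fastforce simp: o_def)
    ultimately show "X = xb" using optimal [OF cluster [OF s X]] xb L_determined by blast
  qed
  then have "(\<lambda>t. (L (Suc t), \<Delta> (Suc t), A (Suc t), B (Suc t))) \<longlonglongrightarrow> (xb, db, ab, bb)"
    by (intro tendsto_Pair db ab bb)
  then have primal: "(\<lambda>t. (L t, \<Delta> t, A t, B t)) \<longlonglongrightarrow> (xb, db, ab, bb)" by (rule LIMSEQ_imp_Suc)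
  \<comment> \<open>Weak duality at the feasible limit bounds every dual value by
    \<open>tnn xb\<close>, and \<open>lower\<close> shows that \<open>(zb, 0)\<close> reaches this
    bound.\<close>
  have "dual_function P y \<le> dual_function P (zb, 0)" for y
  proof -
    have "lagrangian P (xb, db, ab, bb) y = tnn xb"
      using xb by (cases y) (simp add: lagrangian_def primal_optimal_def is_arg_min_def primal_feasible_def)
    then have "dual_function P y \<le> ereal (tnn xb)"
      unfolding dual_function_def by (metis INF_lower UNIV_I)
    also have "\<dots> \<le> dual_function P (zb, 0)"
      unfolding dual_function_def
    proof (rule INF_greatest)
      fix v :: "('M, 'N, 'l) tensor \<times> (real^'H^'p) \<times> (real^'h^'h) \<times> ('M, 'N, 'h) tensor"
      obtain Y d a b where "v = (Y, d, a, b)" by (cases v)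
      then show "ereal (tnn xb) \<le> ereal (lagrangian P v (zb, 0))"
        using lower [OF kkt refl, of Y d] by (simp add: lagrangian_def K_def J_def)
    qed
    finally show ?thesis .
  qed
  then have "dual_optimal P (zb, 0)" by (simp add: dual_optimal_def is_arg_max_linorder)
  moreover have "(\<lambda>t. (O1 t, O2 t)) \<longlonglongrightarrow> (zb, 0)" by (intro tendsto_Pair O1 O2)
  ultimately show ?thesis using xb primal by blast
qed

end
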